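(* Let $\nu\in(0,1)$ and $\lambda>0$. Let $\{X_n:n\geq 1\}$ be i.i.d. real random variables such that $\mathbb{E}[e^{\theta X_1}]<\infty$ for all $\theta$ in a neighborhood of $0$, with $\mu:=\mathbb{E}[X_1]$ and $\sigma^2:=\mathrm{Var}[X_1]$, where $\sigma^2>0$ in the case $\mu=0$; let $\{N_{\nu,\lambda}(t):t\geq 0\}$ be a time fractional Poisson process with parameters $\nu,\lambda$, independent of $\{X_n:n\geq 1\}$. Set $S_{\nu,\lambda}(t):=\sum_{k=1}^{N_{\nu,\lambda}(t)}X_k$ for $t\geq 0$, and let $\alpha(\nu):=1-\nu/2$ if $\mu=0$ and $\alpha(\nu):=1-\nu$ if $\mu\neq 0$. Then, for every family of positive numbers $\{a_t:t>0\}$ such that $a_t\to 0$ and $ta_t\to\infty$ as $t\to\infty$, the family of random variables $\left\{\frac{(a_tt)^{\alpha(\nu)}S_{\nu,\lambda}(t)}{t}:t>0\right\}$ satisfies, as $t\to\infty$, the large deviation principle with speed $1/a_t$ and good rate function $I_{\mathrm{MD},\mu}$ defined as follows: \begin{itemize} \item if $\mu=0$, $$I_{\mathrm{MD},\mu}(x):=\left((\nu/2)^{\nu/(2-\nu)}-(\nu/2)^{2/(2-\nu)}\right)\left(\frac{2x^2}{\lambda\sigma^2}\right)^{1/(2-\nu)},\qquad x\in\mathbb{R};$$ \item if $\mu>0$, $$I_{\mathrm{MD},\mu}(x):=\begin{cases}\left(\nu^{\nu/(1-\nu)}-\nu^{1/(1-\nu)}\right)\left(\frac{x}{\lambda\mu}\right)^{1/(1-\nu)}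 & \text{if } x\geq 0,\\ \infty & \text{if } x<0;\end{cases}$$ \item if $\mu<0$, $$I_{\mathrm{MD},\mu}(x):=\begin{cases}\left(\nu^{\nu/(1-\nu)}-\nu^{1/(1-\nu)}\right)\left(\frac{x}{\lambda\mu}\right)^{1/(1-\nu)} & \text{if } x\leq 0,\\ \infty & \text{if } x>0.\end{cases}$$ \end{itemize}
   Context: Time fractional Poisson process: for $\nu\in(0,1)$ and $\lambda>0$, $N_{\nu,\lambda}(t)=N_{1,\lambda}(L_\nu(t))$ for all $t\geq 0$, where $\{N_{1,\lambda}(t):t\geq 0\}$ is a standard (homogeneous) Poisson process with rate $\lambda$ and $\{L_\nu(t):t\geq 0\}$ is an independent inverse of the stable subordinator, i.e. $L_\nu(t)=\inf\{s\geq 0: D_\nu(s)>t\}$, where $\{D_\nu(s):s\geq 0\}$ is the $\nu$-stable subordinator with $\mathbb{E}[e^{-\xi D_\nu(s)}]=e^{-s\xi^\nu}$ for $\xi\geq 0$. With this normalization $\mathbb{E}[e^{\theta L_\nu(t)}]=E_\nu(\theta t^\nu)$ for all $\theta\in\mathbb{R}$, where $E_\nu(x):=\sum_{k=0}^\infty\frac{x^k}{\Gamma(\nu k+1)}$ is the Mittag-Leffler function. An empty sum is $0$. Large deviation principle (LDP): a speed function is a family $\{v_t:t>0\}$ of numbers with $v_t\to\infty$ as $t\to\infty$; a rate function is a lower semicontinuous function $I:\mathbb{R}\to[0,\infty]$. A family $\{Z_t:t>0\}$ of real random variables satisfies the LDP with speed $v_t$ and rate function $I$ if $\limsup_{t\to\infty}\frac{1}{v_t}\log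 P(Z_t\in C)\leq-\inf_{x\in C}I(x)$ for all closed sets $C\subseteq\mathbb{R}$ and $\liminf_{t\to\infty}\frac{1}{v_t}\log P(Z_t\in O)\geq-\inf_{x\in O}I(x)$ for all open sets $O\subseteq\mathbb{R}$. The rate function $I$ is good if the level set $\{x\in\mathbb{R}:I(x)\leq\beta\}$ is compact for every $\beta\geq 0$. *)

theory Defs
  imports "HOL-Probability.Probability"
begin

section \<open>Processes in continuous time\<close>

text \<open>Processes are indexed by the reals, but only the times \<open>t \<ge> 0\<close> are ever constrained.
  Path properties are required almost surely.\<close>

definition cadlag :: "(real \<Rightarrow> real) \<Rightarrow> bool" where
  "cadlag f \<longleftrightarrow>
     (\<forall>t\<ge>0. (f \<longlongrightarrow> f t) (at_right t)) \<and>
     (\<forall>t>0. \<exists>l. (f \<longlongrightarrow> l) (at_left t))"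

text \<open>Independence of two families of random variables as families, i.e. of the
  sigma-algebras that they generate.\<close>

definition (in prob_space) indep_families ::
  "'b measure \<Rightarrow> 'i set \<Rightarrow> ('i \<Rightarrow> 'a \<Rightarrow> 'b) \<Rightarrow> 'c measure \<Rightarrow> 'j set \<Rightarrow> ('j \<Rightarrow> 'a \<Rightarrow> 'c) \<Rightarrow> bool"
where
  "indep_families S I X T J Y \<longleftrightarrow>
     (\<forall>i\<in>I. random_variable S (X i)) \<and>
     (\<forall>j\<in>J. random_variable T (Y j)) \<and>
     indep_set
       (sigma_sets (space M) (\<Union>i\<in>I. {X i -` A \<inter> space M | A. A \<in> sets S}))
       (sigma_sets (space M) (\<Union>j\<in>J. {Y j -` B \<inter> space M | B. B \<in> sets T}))"

definition (in prob_space) independent_increments :: "(real \<Rightarrow> 'a \<Rightarrow> real) \<Rightarrow> bool" where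
  "independent_increments Y \<longleftrightarrow>
     (\<forall>(n::nat) (\<tau> :: nat \<Rightarrow> real). 0 \<le> \<tau> 0 \<and> (\<forall>i<n. \<tau> i \<le> \<tau> (Suc i)) \<longrightarrow>
        indep_vars (\<lambda>_. borel) (\<lambda>i \<omega>. Y (\<tau> (Suc i)) \<omega> - Y (\<tau> i) \<omega>) {..<n})"

definition (in prob_space) stationary_increments :: "(real \<Rightarrow> 'a \<Rightarrow> real) \<Rightarrow> bool" where
  "stationary_increments Y \<longleftrightarrow>
     (\<forall>s\<ge>0. \<forall>h\<ge>0. distr M borel (\<lambda>\<omega>. Y (s + h) \<omega> - Y s \<omega>) = distr M borel (Y h))"

definition (in prob_space) levy_process :: "(real \<Rightarrow> 'a \<Rightarrow> real) \<Rightarrow> bool" where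
  "levy_process Y \<longleftrightarrow>
     (\<forall>t\<ge>0. random_variable borel (Y t)) \<and>
     (AE \<omega> in M. Y 0 \<omega> = 0) \<and>
     independent_increments Y \<and>
     stationary_increments Y \<and>
     (AE \<omega> in M. cadlag (\<lambda>t. Y t \<omega>))"

definition (in prob_space) poisson_process :: "real \<Rightarrow> (real \<Rightarrow> 'a \<Rightarrow> nat) \<Rightarrow> bool" where
  "poisson_process lambda N \<longleftrightarrow>
     (\<forall>t\<ge>0. random_variable (count_space UNIV) (N t)) \<and>
     levy_process (\<lambda>t \<omega>. real (N t \<omega>)) \<and>
     (\<forall>t>0. distr M (count_space UNIV) (N t) = measure_pmf (poisson_pmf (lambda * t)))"

definition (in prob_space) stable_subordinator :: "real \<Rightarrow> (real \<Rightarrow> 'a \<Rightarrow> real) \<Rightarrow> bool" where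
  "stable_subordinator \<nu> D \<longleftrightarrow>
     levy_process D \<and>
     (AE \<omega> in M. mono_on {0..} (\<lambda>s. D s \<omega>)) \<and>
     (\<forall>s\<ge>0. \<forall>\<xi>\<ge>0. expectation (\<lambda>\<omega>. exp (- \<xi> * D s \<omega>)) = exp (- s * \<xi> powr \<nu>))"

text \<open>The defining identities of the next two processes hold outside a null set: on the null set
  where a path of \<open>D\<close> is irregular or bounded, the infimum is not meaningful
  (\<open>Inf {}\<close> is an unspecified real) and need not be measurable.
  Measurability is therefore stated separately.\<close>

definition (in prob_space) inverse_stable_subordinator ::
  "real \<Rightarrow> (real \<Rightarrow> 'a \<Rightarrow> real) \<Rightarrow> bool"
where
  "inverse_stable_subordinator \<nu> L \<longleftrightarrow>
     (\<forall>t\<ge>0. random_variable borel (L t)) \<and>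
     (\<exists>D. stable_subordinator \<nu> D \<and>
        (AE \<omega> in M. \<forall>t\<ge>0. L t \<omega> = Inf {s. 0 \<le> s \<and> D s \<omega> > t}))"

definition (in prob_space) time_fractional_poisson_process ::
  "real \<Rightarrow> real \<Rightarrow> (real \<Rightarrow> 'a \<Rightarrow> nat) \<Rightarrow> bool"
where
  "time_fractional_poisson_process \<nu> lambda N \<longleftrightarrow>
     (\<forall>t\<ge>0. random_variable (count_space UNIV) (N t)) \<and>
     (\<exists>N1 L. poisson_process lambda N1 \<and> inverse_stable_subordinator \<nu> L \<and>
        indep_families (count_space UNIV) {0..} N1 borel {0..} L \<and>
        (AE \<omega> in M. \<forall>t\<ge>0. N t \<omega> = N1 (L t \<omega>) \<omega>))"

definition random_sum :: "(nat \<Rightarrow> 'a \<Rightarrow> real) \<Rightarrow> (real \<Rightarrow> 'a \<Rightarrow> nat) \<Rightarrow> real \<Rightarrow> 'a \<Rightarrow> real" where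
  "random_sum X N t \<omega> = (\<Sum>k = 1..N t \<omega>. X k \<omega>)"


section \<open>Large deviation principle\<close>

text \<open>Logarithm of a probability, with the convention \<open>log 0 = -\<infinity>\<close>.\<close>

definition log_prob :: "real \<Rightarrow> ereal" where
  "log_prob p = (if p = 0 then - \<infinity> else ereal (ln p))"

definition lower_semicontinuous :: "(real \<Rightarrow> ereal) \<Rightarrow> bool" where
  "lower_semicontinuous I \<longleftrightarrow> (\<forall>x. I x \<le> Liminf (at x) I)"

definition rate_function :: "(real \<Rightarrow> ereal) \<Rightarrow> bool" where
  "rate_function I \<longleftrightarrow> (\<forall>x. 0 \<le> I x) \<and> lower_semicontinuous I"

definition good_rate_function :: "(real \<Rightarrow> ereal) \<Rightarrow> bool" where
  "good_rate_function I \<longleftrightarrow>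
     rate_function I \<and> (\<forall>\<beta>::real. \<beta> \<ge> 0 \<longrightarrow> compact {x. I x \<le> ereal \<beta>})"

definition (in prob_space) satisfies_LDP ::
  "(real \<Rightarrow> 'a \<Rightarrow> real) \<Rightarrow> (real \<Rightarrow> real) \<Rightarrow> (real \<Rightarrow> ereal) \<Rightarrow> bool"
where
  "satisfies_LDP Z v I \<longleftrightarrow>
     (\<forall>t>0. random_variable borel (Z t)) \<and>
     filterlim v at_top at_top \<and>
     rate_function I \<and>
     (\<forall>C. closed C \<longrightarrow>
        Limsup at_top (\<lambda>t. ereal (1 / v t) * log_prob (\<P>(\<omega> in M. Z t \<omega> \<in> C)))
          \<le> - (INF x\<in>C. I x)) \<and>
     (\<forall>U. open U \<longrightarrow>
        Liminf at_top (\<lambda>t. ereal (1 / v t) * log_prob (\<P>(\<omega> in M. Z t \<omega> \<in> U)))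
          \<ge> - (INF x\<in>U. I x))"


section \<open>Scaling exponent and rate function\<close>

definition scaling_exponent :: "real \<Rightarrow> real \<Rightarrow> real" where
  "scaling_exponent \<nu> \<mu> = (if \<mu> = 0 then 1 - \<nu> / 2 else 1 - \<nu>)"

text \<open>The argument \<open>v\<close> is the variance; it only matters for \<open>\<mu> = 0\<close>.\<close>

definition I_MD :: "real \<Rightarrow> real \<Rightarrow> real \<Rightarrow> real \<Rightarrow> real \<Rightarrow> ereal" where
  "I_MD \<nu> lambda \<mu> v x =
     (if \<mu> = 0 then
        ereal (((\<nu> / 2) powr (\<nu> / (2 - \<nu>)) - (\<nu> / 2) powr (2 / (2 - \<nu>)))
               * (2 * x\<^sup>2 / (lambda * v)) powr (1 / (2 - \<nu>)))
      else if \<mu> > 0 then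
        (if x \<ge> 0 then
           ereal ((\<nu> powr (\<nu> / (1 - \<nu>)) - \<nu> powr (1 / (1 - \<nu>)))
                  * (x / (lambda * \<mu>)) powr (1 / (1 - \<nu>)))
         else \<infinity>)
      else
        (if x \<le> 0 then
           ereal ((\<nu> powr (\<nu> / (1 - \<nu>)) - \<nu> powr (1 / (1 - \<nu>)))
                  * (x / (lambda * \<mu>)) powr (1 / (1 - \<nu>)))
         else \<infinity>))"

end

theory Submission
  imports Defs
begin

text \<open>The \<open>X k\<close> enter only through their moment generating function: writing \<open>\<phi>\<close> for it,
  conditioning on \<open>N\<close> and then on \<open>L\<close> gives
  \<open>E exp (\<eta> S t) = E exp (lambda (\<phi> \<eta> - 1) L t)\<close>. Along the scaling of the theorem,
  \<open>lambda (\<phi> \<eta> - 1)\<close> behaves like \<open>r (a t * t) powr - \<nu>\<close>, with \<open>r\<close> linear or quadratic in \<open>\<theta>\<close>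
  depending on whether \<open>\<mu>\<close> vanishes, so the Gaertner-Ellis argument reduces the claim to
  \<open>a t * ln (E exp (r (a t * t) powr - \<nu> * L t)) \<longlonglongrightarrow> max r 0 powr (1 / \<nu>)\<close>.
  This is proved without Mittag-Leffler asymptotics: \<open>L t > s\<close> forces \<open>D s \<le> t\<close>, whose probability is
  bounded by Chernoff's inequality for the subordinator \<open>D\<close>; conversely \<open>D s \<le> t\<close> forces
  \<open>L t \<ge> s\<close>, and a matching lower bound for \<open>D s \<le> t\<close> comes from the lower half of the
  Gaertner-Ellis argument applied to \<open>D\<close> itself, with \<open>s\<close> chosen optimally.\<close>

section \<open>Exponential scale bounds and the Gaertner-Ellis theorem\<close>

text \<open>The limit in the overview is what the Mittag-Leffler function predicts: by
  self-similarity the moment is \<open>E_\<nu>\<close> at \<open>x = r * a t powr - \<nu>\<close>,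
  which grows like \<open>exp (x powr (1 / \<nu>))\<close> for positive \<open>r\<close> and decays
  only polynomially for negative \<open>r\<close>. At speed \<open>1 / a t\<close> polynomial decay
  is invisible, hence the maximum with 0. The moment generating function of \<open>X 1\<close> is
  known to be finite only near 0. For each fixed \<open>\<theta>\<close> its argument tends to 0, so
  the cumulant limit exists for every \<open>\<theta>\<close>, but only for large \<open>t\<close>;
  this is why the bounds are eventual ones on integrals with values in
  \<open>[0, \<infinity>]\<close>. The limit is a power with exponent greater than 1, two-sided for
  \<open>\<mu> = 0\<close> and one-sided otherwise, so it is differentiable also at 0. Every point
  of finite rate is its slope at some \<open>\<theta>\<close> of the same sign, and that sign
  condition reduces the upper bound for a closed set to two half-lines. Where the rate is infinite,
  the limit vanishes on the whole half-line of \<open>\<theta>\<close> with the sign of that point.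
  The case \<open>\<mu> = 0\<close> has the form of the other one with \<open>\<nu> / 2\<close> in
  place of \<open>\<nu>\<close>.\<close>

definition log_limsup_le :: "('i \<Rightarrow> real) \<Rightarrow> 'i filter \<Rightarrow> ('i \<Rightarrow> ennreal) \<Rightarrow> real \<Rightarrow> bool" where
  "log_limsup_le a F f c \<longleftrightarrow> (\<forall>b>c. \<forall>\<^sub>F i in F. f i \<le> ennreal (exp (b / a i)))"

text \<open>Both predicates bound limits of \<open>a i * ln (f i)\<close> by comparison with
  exponentials. In this form \<open>f i\<close> may be an integral equal to 0 or
  \<open>\<infinity>\<close>, and no logarithm of an extended real arises.\<close>

definition log_liminf_ge :: "('i \<Rightarrow> real) \<Rightarrow> 'i filter \<Rightarrow> ('i \<Rightarrow> ennreal) \<Rightarrow> real \<Rightarrow> bool" where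
  "log_liminf_ge a F f c \<longleftrightarrow> (\<forall>b<c. \<forall>\<^sub>F i in F. ennreal (exp (b / a i)) \<le> f i)"

lemma log_limsup_leD: "log_limsup_le a F f c \<Longrightarrow> c < b \<Longrightarrow> \<forall>\<^sub>F i in F. f i \<le> ennreal (exp (b / a i))"
  by (auto simp: log_limsup_le_def)

lemma log_liminf_geD: "log_liminf_ge a F f c \<Longrightarrow> b < c \<Longrightarrow> \<forall>\<^sub>F i in F. ennreal (exp (b / a i)) \<le> f i"
  by (auto simp: log_liminf_ge_def)

text \<open>Since \<open>1 / a i\<close> tends to infinity, any strict gap between two exponents
  swallows a constant factor.\<close>

lemma eventually_mult_exp_le:
  fixes a :: "'i \<Rightarrow> real"
  assumes a: "filterlim a (at_right 0) F" and "c < b"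
  shows "\<forall>\<^sub>F i in F. K * exp (c / a i) \<le> exp (b / a i)"
proof -
  have "filterlim (\<lambda>i. inverse (a i)) at_top F"
    using filterlim_compose[OF filterlim_inverse_at_top_right a] .
  then have "filterlim (\<lambda>i. (b - c) * inverse (a i)) at_top F"
    using \<open>c < b\<close> by (intro filterlim_tendsto_pos_mult_at_top[OF tendsto_const]) auto
  then have "filterlim (\<lambda>i. exp ((b - c) * inverse (a i))) at_top F"
    using filterlim_compose[OF exp_at_top] by blast
  then have "\<forall>\<^sub>F i in F. K \<le> exp ((b - c) * inverse (a i))"
    by (simp add: filterlim_at_top)
  then show ?thesis
  proof eventually_elim
    case (elim i)
    have "K * exp (c / a i) \<le> exp ((b - c) * inverse (a i)) * exp (c / a i)"
      using elim by (intro mult_right_mono) auto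
    also have "\<dots> = exp (b / a i)"
      by (simp add: exp_add[symmetric] field_simps diff_divide_distrib)
    finally show ?case .
  qed
qed

lemma log_limsup_le_add:
  assumes a: "filterlim a (at_right 0) F"
    and f: "log_limsup_le a F f c" and g: "log_limsup_le a F g c"
  shows "log_limsup_le a F (\<lambda>i. f i + g i) c"
  unfolding log_limsup_le_def
proof (intro allI impI)
  fix b assume "c < b"
  then obtain b' where b': "c < b'" "b' < b" using dense by blast
  from log_limsup_leD[OF f b'(1)] log_limsup_leD[OF g b'(1)] eventually_mult_exp_le[OF a b'(2), of 2]
  show "\<forall>\<^sub>F i in F. f i + g i \<le> ennreal (exp (b / a i))"
  proof eventually_elim
    case (elim i)
    have "f i + g i \<le> ennreal (exp (b' / a i)) + ennreal (exp (b' / a i))"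
      using elim by (intro add_mono) auto
    also have "\<dots> = ennreal (2 * exp (b' / a i))"
      by (simp flip: ennreal_plus)
    also have "\<dots> \<le> ennreal (exp (b / a i))"
      using elim by (intro ennreal_leI) auto
    finally show ?case .
  qed
qed

lemma log_limsup_le_exp_mult:
  assumes f: "log_limsup_le a F f c"
  shows "log_limsup_le a F (\<lambda>i. ennreal (exp (d / a i)) * f i) (d + c)"
  unfolding log_limsup_le_def
proof (intro allI impI)
  fix b assume "d + c < b"
  then have "c < b - d" by simp
  from log_limsup_leD[OF f this]
  show "\<forall>\<^sub>F i in F. ennreal (exp (d / a i)) * f i \<le> ennreal (exp (b / a i))"
  proof eventually_elim
    case (elim i)
    have "ennreal (exp (d / a i)) * f i \<le> ennreal (exp (d / a i)) * ennreal (exp ((b - d) / a i))"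
      using elim by (intro mult_left_mono) auto
    also have "\<dots> = ennreal (exp (b / a i))"
      by (simp add: ennreal_mult[symmetric] exp_add[symmetric] diff_divide_distrib)
    finally show ?case .
  qed
qed

lemma log_limsup_le_mono:
  assumes "log_limsup_le a F g c" "\<forall>\<^sub>F i in F. f i \<le> g i"
  shows "log_limsup_le a F f c"
  unfolding log_limsup_le_def
proof (intro allI impI)
  fix b assume "c < b"
  from log_limsup_leD[OF assms(1) this] assms(2)
  show "\<forall>\<^sub>F i in F. f i \<le> ennreal (exp (b / a i))"
    by eventually_elim auto
qed

lemma log_limsup_le_weaken:
  assumes "log_limsup_le a F f c" "c \<le> c'"
  shows "log_limsup_le a F f c'"
  using assms unfolding log_limsup_le_def by auto

lemma log_liminf_ge_mono:
  assumes "log_liminf_ge a F g c" "\<forall>\<^sub>F i in F. g i \<le> f i"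
  shows "log_liminf_ge a F f c"
  unfolding log_liminf_ge_def
proof (intro allI impI)
  fix b assume "b < c"
  from log_liminf_geD[OF assms(1) this] assms(2)
  show "\<forall>\<^sub>F i in F. ennreal (exp (b / a i)) \<le> f i"
    by eventually_elim auto
qed

section \<open>Chernoff bounds and the local lower bound by exponential tilting\<close>

context prob_space
begin

text \<open>On the event, \<open>exp (h * (Z - y) / a)\<close> is at least 1 and may be inserted as
  a factor. The sign of \<open>h\<close> selects the upper or the lower tail, and the weight with
  \<open>\<theta>\<close> makes the bound apply to a tilted law.\<close>

lemma chernoff_nn_integral:
  assumes [measurable]: "Z \<in> borel_measurable M" and "0 < a"
  shows "(\<integral>\<^sup>+\<omega>. ennreal (exp (\<theta> * Z \<omega> / a)) * indicator {\<omega>\<in>space M. h * y \<le> h * Z \<omega>} \<omega> \<partial>M)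
         \<le> ennreal (exp (- (h * y) / a)) * (\<integral>\<^sup>+\<omega>. ennreal (exp ((\<theta> + h) * Z \<omega> / a)) \<partial>M)"
proof -
  have "(\<integral>\<^sup>+\<omega>. ennreal (exp (\<theta> * Z \<omega> / a)) * indicator {\<omega>\<in>space M. h * y \<le> h * Z \<omega>} \<omega> \<partial>M)
        \<le> (\<integral>\<^sup>+\<omega>. ennreal (exp (- (h * y) / a)) * ennreal (exp ((\<theta> + h) * Z \<omega> / a)) \<partial>M)"
  proof (intro nn_integral_mono)
    fix \<omega>
    have "exp (\<theta> * Z \<omega> / a) \<le> exp (- (h * y) / a) * exp ((\<theta> + h) * Z \<omega> / a)"
      if "h * y \<le> h * Z \<omega>"
    proof -
      have "\<theta> * Z \<omega> / a \<le> - (h * y) / a + (\<theta> + h) * Z \<omega> / a"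
        using that \<open>0 < a\<close> by (simp add: add_divide_distrib[symmetric] divide_right_mono algebra_simps)
      then show ?thesis by (simp flip: exp_add)
    qed
    then show "ennreal (exp (\<theta> * Z \<omega> / a)) * indicator {\<omega>\<in>space M. h * y \<le> h * Z \<omega>} \<omega>
        \<le> ennreal (exp (- (h * y) / a)) * ennreal (exp ((\<theta> + h) * Z \<omega> / a))"
      by (auto simp: indicator_def ennreal_mult[symmetric] intro!: ennreal_leI)
  qed
  also have "\<dots> = ennreal (exp (- (h * y) / a)) * (\<integral>\<^sup>+\<omega>. ennreal (exp ((\<theta> + h) * Z \<omega> / a)) \<partial>M)"
    by (rule nn_integral_cmult) measurable
  finally show ?thesis .
qed

lemma chernoff_emeasure:
  assumes [measurable]: "Z \<in> borel_measurable M" and "0 < a"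
  shows "emeasure M {\<omega>\<in>space M. h * y \<le> h * Z \<omega>}
         \<le> ennreal (exp (- (h * y) / a)) * (\<integral>\<^sup>+\<omega>. ennreal (exp (h * Z \<omega> / a)) \<partial>M)"
  using chernoff_nn_integral[OF assms, of 0 h y] by simp

text \<open>The tails of the exponentially tilted law are negligible by Chernoff's bound with a parameter
  close to \<open>\<theta>\<close>, because \<open>x\<close> is the derivative of the limiting cumulant function at \<open>\<theta>\<close>.\<close>

lemma log_liminf_ge_ball:
  fixes \<Lambda> :: "real \<Rightarrow> real"
  assumes a: "filterlim a (at_right 0) F"
    and meas: "\<forall>\<^sub>F i in F. Z i \<in> borel_measurable M"
    and lower: "log_liminf_ge a F (\<lambda>i. \<integral>\<^sup>+\<omega>. ennreal (exp (\<theta> * Z i \<omega> / a i)) \<partial>M) (\<Lambda> \<theta>)"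
    and upper: "\<forall>\<^sub>F \<eta> in nhds \<theta>.
      log_limsup_le a F (\<lambda>i. \<integral>\<^sup>+\<omega>. ennreal (exp (\<eta> * Z i \<omega> / a i)) \<partial>M) (\<Lambda> \<eta>)"
    and deriv: "(\<Lambda> has_real_derivative x) (at \<theta>)"
    and "\<epsilon> > 0"
  shows "log_liminf_ge a F (\<lambda>i. emeasure M {\<omega>\<in>space M. \<bar>Z i \<omega> - x\<bar> < \<epsilon>}) (\<Lambda> \<theta> - \<theta> * x)"
  unfolding log_liminf_ge_def
proof (intro allI impI)
  fix b assume b: "b < \<Lambda> \<theta> - \<theta> * x"
  have apos: "\<forall>\<^sub>F i in F. 0 < a i"
    using a by (auto simp: filterlim_at elim: eventually_mono)
  define \<Delta> where "\<Delta> = \<Lambda> \<theta> - \<theta> * x - b"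
  have \<Delta>: "\<Delta> > 0" using b by (simp add: \<Delta>_def)
  \<comment> \<open>Undoing the tilt on a ball of radius \<open>e\<close> costs at most
    \<open>\<bar>\<theta>\<bar> * e\<close> in the exponent, which this choice keeps below the
    available slack \<open>\<Delta>\<close>; the summand 1 covers
    \<open>\<theta> = 0\<close>.\<close>
  define e where "e = min \<epsilon> (\<Delta> / (2 * (\<bar>\<theta>\<bar> + 1)))"
  have e: "e > 0" "e \<le> \<epsilon>" using \<Delta> \<open>\<epsilon> > 0\<close> by (auto simp: e_def)
  have "\<bar>\<theta>\<bar> * e \<le> \<bar>\<theta>\<bar> * (\<Delta> / (2 * (\<bar>\<theta>\<bar> + 1)))"
    by (intro mult_left_mono) (auto simp: e_def)
  also have "\<dots> < \<Delta>" using \<Delta> by (simp add: field_simps add_nonneg_pos)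
  finally have \<theta>e: "b + \<theta> * x + \<bar>\<theta>\<bar> * e < \<Lambda> \<theta>" by (simp add: \<Delta>_def)
  have "((\<lambda>h. (\<Lambda> (\<theta> + h) - \<Lambda> \<theta>) / h) \<longlongrightarrow> x) (at 0)"
    using deriv by (simp add: DERIV_def)
  then have "\<forall>\<^sub>F h in at 0. \<bar>(\<Lambda> (\<theta> + h) - \<Lambda> \<theta>) / h - x\<bar> < e"
    using e(1) by (auto simp: tendsto_iff dist_real_def)
  moreover have "\<forall>\<^sub>F h in at 0. log_limsup_le a F (\<lambda>i. \<integral>\<^sup>+\<omega>. ennreal (exp ((\<theta> + h) * Z i \<omega> / a i)) \<partial>M) (\<Lambda> (\<theta> + h))"
  proof -
    have "filterlim (\<lambda>h. \<theta> + h) (nhds \<theta>) (at 0)"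
      by (auto intro!: tendsto_eq_intros)
    from eventually_compose_filterlim[OF upper this] show ?thesis .
  qed
  \<comment> \<open>Chernoff's bound gains \<open>\<bar>h\<bar> * e\<close> at distance
    \<open>e\<close> from \<open>x\<close>. The first-order error of \<open>\<Lambda>\<close> is
    smaller than this gain, so both tail exponents end up strictly below
    \<open>\<Lambda> \<theta>\<close>.\<close>
  ultimately have ev: "\<forall>\<^sub>F h in at 0. \<Lambda> (\<theta> + h) < \<Lambda> \<theta> + h * x + \<bar>h\<bar> * e \<and>
     log_limsup_le a F (\<lambda>i. \<integral>\<^sup>+\<omega>. ennreal (exp ((\<theta> + h) * Z i \<omega> / a i)) \<partial>M) (\<Lambda> (\<theta> + h))"
    using eventually_neq_at_within[of 0 0]
  proof eventually_elim
    case (elim h)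
    have "\<bar>\<Lambda> (\<theta> + h) - \<Lambda> \<theta> - h * x\<bar> = \<bar>h\<bar> * \<bar>(\<Lambda> (\<theta> + h) - \<Lambda> \<theta>) / h - x\<bar>"
      using elim(3) by (simp add: abs_mult[symmetric] field_simps)
    also have "\<dots> < \<bar>h\<bar> * e" using elim by (intro mult_strict_left_mono) auto
    finally show ?case using elim by auto
  qed
  then obtain d where "d > 0" and d: "\<And>h. h \<noteq> 0 \<Longrightarrow> \<bar>h\<bar> < d \<Longrightarrow> \<Lambda> (\<theta> + h) < \<Lambda> \<theta> + h * x + \<bar>h\<bar> * e \<and>
     log_limsup_le a F (\<lambda>i. \<integral>\<^sup>+\<omega>. ennreal (exp ((\<theta> + h) * Z i \<omega> / a i)) \<partial>M) (\<Lambda> (\<theta> + h))"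
    by (auto simp: eventually_at dist_real_def)
  define h where "h = d / 2"
  have h: "h > 0" "h < d" using \<open>d > 0\<close> by (auto simp: h_def)
  have hp: "\<Lambda> (\<theta> + h) - h * (x + e) < \<Lambda> \<theta>"
      "log_limsup_le a F (\<lambda>i. \<integral>\<^sup>+\<omega>. ennreal (exp ((\<theta> + h) * Z i \<omega> / a i)) \<partial>M) (\<Lambda> (\<theta> + h))"
    using d[of h] h by (auto simp: algebra_simps)
  have hm: "\<Lambda> (\<theta> - h) + h * (x - e) < \<Lambda> \<theta>"
      "log_limsup_le a F (\<lambda>i. \<integral>\<^sup>+\<omega>. ennreal (exp ((\<theta> - h) * Z i \<omega> / a i)) \<partial>M) (\<Lambda> (\<theta> - h))"
    using d[of "-h"] h by (auto simp: algebra_simps)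
  define c where "c = max (\<Lambda> (\<theta> + h) - h * (x + e)) (\<Lambda> (\<theta> - h) + h * (x - e))"
  have c: "c < \<Lambda> \<theta>" using hp hm by (simp add: c_def)
  define T where "T i = ennreal (exp (- (h * (x + e)) / a i)) * (\<integral>\<^sup>+\<omega>. ennreal (exp ((\<theta> + h) * Z i \<omega> / a i)) \<partial>M)
      + ennreal (exp ((h * (x - e)) / a i)) * (\<integral>\<^sup>+\<omega>. ennreal (exp ((\<theta> - h) * Z i \<omega> / a i)) \<partial>M)" for i
  have T: "log_limsup_le a F T c"
    unfolding T_def
  proof (rule log_limsup_le_add[OF a])
    show "log_limsup_le a F (\<lambda>i. ennreal (exp (- (h * (x + e)) / a i)) * (\<integral>\<^sup>+\<omega>. ennreal (exp ((\<theta> + h) * Z i \<omega> / a i)) \<partial>M)) c"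
      by (rule log_limsup_le_weaken[OF log_limsup_le_exp_mult[OF hp(2)]]) (simp add: c_def)
    show "log_limsup_le a F (\<lambda>i. ennreal (exp ((h * (x - e)) / a i)) * (\<integral>\<^sup>+\<omega>. ennreal (exp ((\<theta> - h) * Z i \<omega> / a i)) \<partial>M)) c"
      by (rule log_limsup_le_weaken[OF log_limsup_le_exp_mult[OF hm(2)]]) (simp add: c_def)
  qed
  obtain c' where c': "c < c'" "c' < \<Lambda> \<theta>" using c dense by blast
  \<comment> \<open>\<open>b'\<close> dominates the exponent \<open>c'\<close> of the tails and that
    of the tilted target. The gap between \<open>b'\<close> and \<open>b''\<close> provides a factor
    2, so that the target remains after the tails are subtracted from the total mass.\<close>
  define b' where "b' = max (b + \<theta> * x + \<bar>\<theta>\<bar> * e) c'"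
  have b': "b' < \<Lambda> \<theta>" using \<theta>e c' by (simp add: b'_def)
  then obtain b'' where b'': "b' < b''" "b'' < \<Lambda> \<theta>" using dense by blast
  from log_limsup_leD[OF T c'(1)] log_liminf_geD[OF lower b''(2)] apos meas
    eventually_mult_exp_le[OF a b''(1), of 2]
  show "\<forall>\<^sub>F i in F. ennreal (exp (b / a i)) \<le> emeasure M {\<omega>\<in>space M. \<bar>Z i \<omega> - x\<bar> < \<epsilon>}"
  proof eventually_elim
    case (elim i)
    note [measurable] = elim(4)
    let ?B = "{\<omega>\<in>space M. \<bar>Z i \<omega> - x\<bar> < e}"
    let ?U = "{\<omega>\<in>space M. h * (x + e) \<le> h * Z i \<omega>}"
    let ?L = "{\<omega>\<in>space M. - h * (x - e) \<le> - h * Z i \<omega>}"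
    let ?E = "\<lambda>\<omega>. ennreal (exp (\<theta> * Z i \<omega> / a i))"
    have "?E \<omega> * indicator ?B \<omega> \<le> ennreal (exp ((\<theta> * x + \<bar>\<theta>\<bar> * e) / a i)) * indicator ?B \<omega>" for \<omega>
    proof (cases "\<omega> \<in> ?B")
      case True
      have "\<theta> * (Z i \<omega> - x) \<le> \<bar>\<theta>\<bar> * \<bar>Z i \<omega> - x\<bar>" by (metis abs_ge_self abs_mult)
      also have "\<dots> \<le> \<bar>\<theta>\<bar> * e" using True by (intro mult_left_mono) auto
      finally have "\<theta> * Z i \<omega> / a i \<le> (\<theta> * x + \<bar>\<theta>\<bar> * e) / a i"
        using elim(3) by (intro divide_right_mono) (auto simp: algebra_simps)
      then show ?thesis by (auto intro!: mult_right_mono ennreal_leI)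
    qed auto
    then have B: "(\<integral>\<^sup>+\<omega>. ?E \<omega> * indicator ?B \<omega> \<partial>M)
        \<le> ennreal (exp ((\<theta> * x + \<bar>\<theta>\<bar> * e) / a i)) * emeasure M ?B"
      by (subst nn_integral_cmult_indicator[symmetric]) (auto intro!: nn_integral_mono)
    have "ennreal (exp (b'' / a i)) \<le> (\<integral>\<^sup>+\<omega>. ?E \<omega> \<partial>M)" by fact
    also have "\<dots> \<le> (\<integral>\<^sup>+\<omega>. ?E \<omega> * indicator ?B \<omega> + (?E \<omega> * indicator ?U \<omega> + ?E \<omega> * indicator ?L \<omega>) \<partial>M)"
    proof (intro nn_integral_mono)
      fix \<omega> assume "\<omega> \<in> space M"
      moreover have "\<omega> \<in> ?B \<or> \<omega> \<in> ?U \<or> \<omega> \<in> ?L"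
        using h \<open>\<omega> \<in> space M\<close> by auto
      ultimately show "?E \<omega> \<le> ?E \<omega> * indicator ?B \<omega> + (?E \<omega> * indicator ?U \<omega> + ?E \<omega> * indicator ?L \<omega>)"
        by (auto simp: indicator_def)
    qed
    also have "\<dots> = (\<integral>\<^sup>+\<omega>. ?E \<omega> * indicator ?B \<omega> \<partial>M) + ((\<integral>\<^sup>+\<omega>. ?E \<omega> * indicator ?U \<omega> \<partial>M) + (\<integral>\<^sup>+\<omega>. ?E \<omega> * indicator ?L \<omega> \<partial>M))"
      by (subst nn_integral_add, measurable, subst nn_integral_add, measurable)
    also have "\<dots> \<le> ennreal (exp ((\<theta> * x + \<bar>\<theta>\<bar> * e) / a i)) * emeasure M ?B + T i"
      unfolding T_def
      using chernoff_nn_integral[OF elim(4,3), of \<theta> h "x + e"] chernoff_nn_integral[OF elim(4,3), of \<theta> "-h" "x - e"]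
      by (intro add_mono B) (simp_all add: algebra_simps)
    also have "\<dots> \<le> ennreal (exp ((\<theta> * x + \<bar>\<theta>\<bar> * e) / a i)) * ennreal (prob ?B) + ennreal (exp (c' / a i))"
      using elim(1) by (intro add_mono) (auto simp: emeasure_eq_measure)
    also have "\<dots> = ennreal (exp ((\<theta> * x + \<bar>\<theta>\<bar> * e) / a i) * prob ?B + exp (c' / a i))"
      by (simp add: ennreal_mult)
    finally have 1: "exp (b'' / a i) \<le> exp ((\<theta> * x + \<bar>\<theta>\<bar> * e) / a i) * prob ?B + exp (c' / a i)"
      by (subst (asm) ennreal_le_iff) (auto intro: add_nonneg_nonneg)
    have "exp (c' / a i) \<le> exp (b' / a i)" "exp ((b + (\<theta> * x + \<bar>\<theta>\<bar> * e)) / a i) \<le> exp (b' / a i)"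
      using elim(3) by (auto simp: b'_def add.assoc intro!: divide_right_mono)
    with 1 elim(5) have "exp ((b + (\<theta> * x + \<bar>\<theta>\<bar> * e)) / a i) \<le> exp ((\<theta> * x + \<bar>\<theta>\<bar> * e) / a i) * prob ?B"
      by linarith
    then have "exp (b / a i) \<le> prob ?B"
      by (simp add: add_divide_distrib[of b] exp_add)
    also have "\<dots> \<le> prob {\<omega>\<in>space M. \<bar>Z i \<omega> - x\<bar> < \<epsilon>}"
      using e by (intro finite_measure_mono) auto
    finally show ?case by (auto simp: emeasure_eq_measure intro: ennreal_leI)
  qed
qed

end

section \<open>From exponential bounds to the large deviation principle\<close>

lemma ereal_mult_log_prob_le:
  assumes "0 < a" "0 \<le> p" "p \<le> exp (b / a)"
  shows "ereal a * log_prob p \<le> ereal b"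
proof (cases "p = 0")
  case False
  then have "ln p \<le> b / a"
    using assms by (metis exp_gt_zero ln_exp ln_le_cancel_iff order_le_less)
  then show ?thesis using False assms by (simp add: log_prob_def field_simps)
qed (use assms in \<open>simp add: log_prob_def\<close>)

lemma ereal_mult_log_prob_ge:
  assumes "0 < a" "exp (b / a) \<le> p"
  shows "ereal b \<le> ereal a * log_prob p"
proof -
  have "0 < p" using assms(2) by (rule less_le_trans[OF exp_gt_zero])
  then have "b / a \<le> ln p" using assms by (simp add: ln_ge_iff)
  then show ?thesis using \<open>0 < p\<close> assms by (simp add: log_prob_def field_simps)
qed

lemma filterlim_at_right_0_at_topI:
  fixes a :: "real \<Rightarrow> real"
  assumes "\<And>t. t > 0 \<Longrightarrow> a t > 0" and "(a \<longlongrightarrow> 0) at_top"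
  shows "filterlim a (at_right 0) at_top"
  unfolding filterlim_at
proof
  show "\<forall>\<^sub>F t in at_top. a t \<in> {0<..} \<and> a t \<noteq> 0"
    using eventually_gt_at_top[of 0] by eventually_elim (use assms(1) in force)
qed fact

text \<open>The lower bound tilts at the \<open>\<theta>\<close> whose slope is the given point. The
  upper bound uses that Chernoff's bound at a \<open>\<theta>\<close> with
  \<open>0 \<le> \<theta> * x\<close> controls the whole half-line beyond \<open>x\<close>; a closed
  set avoiding 0 lies in at most two such half-lines, and a closed set containing 0 has infimum 0
  because \<open>I 0 = 0\<close>.\<close>

theorem (in prob_space) gartner_ellis:
  fixes a :: "real \<Rightarrow> real" and \<Lambda> :: "real \<Rightarrow> real" and I :: "real \<Rightarrow> ereal"
  assumes meas: "\<And>t. t > 0 \<Longrightarrow> Z t \<in> borel_measurable M"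
    and a_pos: "\<And>t. t > 0 \<Longrightarrow> a t > 0" and a_lim: "(a \<longlongrightarrow> 0) at_top"
    and lower: "\<And>\<theta>. log_liminf_ge a at_top (\<lambda>t. \<integral>\<^sup>+\<omega>. ennreal (exp (\<theta> * Z t \<omega> / a t)) \<partial>M) (\<Lambda> \<theta>)"
    and upper: "\<And>\<theta>. log_limsup_le a at_top (\<lambda>t. \<integral>\<^sup>+\<omega>. ennreal (exp (\<theta> * Z t \<omega> / a t)) \<partial>M) (\<Lambda> \<theta>)"
    and rate: "rate_function I" and I_0: "I 0 = 0"
    and fin: "\<And>x. I x \<noteq> \<infinity> \<Longrightarrow>
        \<exists>\<theta>. (\<Lambda> has_real_derivative x) (at \<theta>) \<and> I x = ereal (\<theta> * x - \<Lambda> \<theta>) \<and> 0 \<le> \<theta> * x"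
    and infin: "\<And>x c. I x = \<infinity> \<Longrightarrow> \<exists>\<theta>. 0 \<le> \<theta> * x \<and> c \<le> \<theta> * x - \<Lambda> \<theta>"
  shows "satisfies_LDP Z (\<lambda>t. 1 / a t) I"
proof -
  have apos: "\<forall>\<^sub>F t in at_top. 0 < a t"
    using eventually_gt_at_top[of 0] by eventually_elim (rule a_pos)
  have a: "filterlim a (at_right 0) at_top"
    by (rule filterlim_at_right_0_at_topI[OF a_pos a_lim])
  have ev_meas: "\<forall>\<^sub>F t in at_top. Z t \<in> borel_measurable M"
    using eventually_gt_at_top[of 0] by eventually_elim (rule meas)
  \<comment> \<open>\<open>x * x \<le> x * z\<close> describes the half-line that starts at
    \<open>x\<close> and points away from 0, for both signs of \<open>x\<close> at once.\<close>
  have half_line: "log_limsup_le a at_top (\<lambda>t. emeasure M {\<omega>\<in>space M. x * x \<le> x * Z t \<omega>}) (- c)"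
    if "x \<noteq> 0" "ereal c < I x" for x c
  proof -
    obtain \<theta> where \<theta>: "0 \<le> \<theta> * x" "c \<le> \<theta> * x - \<Lambda> \<theta>"
    proof (cases "I x = \<infinity>")
      case True
      from infin[OF this, of c] that show ?thesis by blast
    next
      case False
      from fin[OF this] obtain \<theta> where "I x = ereal (\<theta> * x - \<Lambda> \<theta>)" "0 \<le> \<theta> * x" by blast
      with \<open>ereal c < I x\<close> that show ?thesis by auto
    qed
    \<comment> \<open>The sign condition enters here: the inequality is multiplied by
      \<open>\<theta> * x \<ge> 0\<close>, then \<open>x * x > 0\<close> is cancelled.\<close>
    have imp: "\<theta> * x \<le> \<theta> * z" if "x * x \<le> x * z" for z
    proof -
      have "\<theta> * x * (x * x) \<le> \<theta> * x * (x * z)" by (rule mult_left_mono[OF that \<theta>(1)])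
      then have "(x * x) * (\<theta> * x) \<le> (x * x) * (\<theta> * z)" by (simp add: mult_ac)
      moreover have "0 < x * x" using \<open>x \<noteq> 0\<close> by (auto simp: zero_less_mult_iff linorder_neq_iff)
      ultimately show ?thesis by (simp only: mult_le_cancel_left_pos)
    qed
    have bound: "log_limsup_le a at_top
       (\<lambda>t. ennreal (exp (- (\<theta> * x) / a t)) * (\<integral>\<^sup>+\<omega>. ennreal (exp (\<theta> * Z t \<omega> / a t)) \<partial>M)) (- (\<theta> * x) + \<Lambda> \<theta>)"
      by (rule log_limsup_le_exp_mult[OF upper])
    have "\<forall>\<^sub>F t in at_top. emeasure M {\<omega>\<in>space M. x * x \<le> x * Z t \<omega>}
        \<le> ennreal (exp (- (\<theta> * x) / a t)) * (\<integral>\<^sup>+\<omega>. ennreal (exp (\<theta> * Z t \<omega> / a t)) \<partial>M)"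
      using apos ev_meas
    proof eventually_elim
      case (elim t)
      note [measurable] = elim(2)
      have "emeasure M {\<omega>\<in>space M. x * x \<le> x * Z t \<omega>} \<le> emeasure M {\<omega>\<in>space M. \<theta> * x \<le> \<theta> * Z t \<omega>}"
        by (intro emeasure_mono) (auto intro: imp)
      also note chernoff_emeasure[OF elim(2,1), of \<theta> x]
      finally show ?case .
    qed
    from log_limsup_le_mono[OF bound this] show ?thesis
      by (rule log_limsup_le_weaken) (use \<theta>(2) in simp)
  qed
  have closed: "Limsup at_top (\<lambda>t. ereal (a t) * log_prob (\<P>(\<omega> in M. Z t \<omega> \<in> C))) \<le> - (INF x\<in>C. I x)"
    if "closed C" for C
    unfolding Limsup_le_iff
  proof (intro allI impI)
    fix y assume "- (INF x\<in>C. I x) < y"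
    then obtain b where b: "- (INF x\<in>C. I x) < ereal b" "ereal b < y" by (meson ereal_dense2)
    have "- ereal b < (INF x\<in>C. I x)" using b(1) by (simp add: ereal_uminus_less_reorder)
    then have "ereal (- b) < (INF x\<in>C. I x)" by simp
    then obtain m where m: "- b < m" "ereal m < (INF x\<in>C. I x)"
      by (metis ereal_dense2 less_ereal.simps(1))
    have mI: "ereal m < I x" if "x \<in> C" for x
      using m(2) INF_lower[OF that, of I] by (rule less_le_trans)
    have "\<forall>\<^sub>F t in at_top. emeasure M {\<omega>\<in>space M. Z t \<omega> \<in> C} \<le> ennreal (exp (b / a t))"
    proof (cases "0 \<in> C")
      case True
      \<comment> \<open>The infimum over \<open>C\<close> is at most \<open>I 0 = 0\<close>, so the
        bound to be shown exceeds 1 and is trivial for a probability.\<close>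
      then have "0 < b" using mI[OF True] m(1) I_0 by simp
      from apos show ?thesis
      proof eventually_elim
        case (elim t)
        have "emeasure M {\<omega>\<in>space M. Z t \<omega> \<in> C} \<le> ennreal 1"
          by (simp add: emeasure_le_1)
        also have "\<dots> \<le> ennreal (exp (b / a t))"
          using \<open>0 < b\<close> elim by (intro ennreal_leI) simp
        finally show ?case .
      qed
    next
      case False
      \<comment> \<open>The witness is the point of \<open>C\<close> nearest to 0 on the side given
        by \<open>s\<close>, with 0 as the default value when \<open>C\<close> has no point on that
        side.\<close>
      have side: "\<exists>x. (x \<noteq> 0 \<longrightarrow> x \<in> C) \<and> (\<forall>z\<in>C. 0 < s * z \<longrightarrow> x \<noteq> 0 \<and> x * x \<le> x * z)"
        if s: "s = 1 \<or> s = -1" for s :: real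
      proof (cases "\<exists>z\<in>C. 0 < s * z")
        case True
        define D where "D = (\<lambda>z. s * z) ` C \<inter> {0..}"
        have D: "closed D" "D \<noteq> {}" "bdd_below D"
          using that \<open>closed C\<close> True s by (auto simp: D_def intro!: closed_Int closed_negations bdd_belowI[of _ 0])
        define d where "d = Inf D"
        have "d \<in> D" using closed_contains_Inf D d_def by blast
        then have sd: "s * d \<in> C" "0 \<le> d" using s by (auto simp: D_def)
        have d: "s * d * (s * d) \<le> s * d * z" if "z \<in> C" "0 < s * z" for z
        proof -
          have "d \<le> s * z"
            unfolding d_def using that D(3) by (intro cInf_lower) (auto simp: D_def)
          then have "d * d \<le> d * (s * z)" using sd(2) by (rule mult_left_mono)
          then show ?thesis using s by auto
        qed
        have "s * d \<noteq> 0" using sd(1) False by auto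
        with sd(1) d show ?thesis by blast
      qed (auto intro!: exI[of _ 0])
      from side[of 1] obtain p where p: "p \<noteq> 0 \<longrightarrow> p \<in> C"
        "\<forall>z\<in>C. 0 < z \<longrightarrow> p \<noteq> 0 \<and> p * p \<le> p * z" by auto
      from side[of "-1"] obtain n where n: "n \<noteq> 0 \<longrightarrow> n \<in> C"
        "\<forall>z\<in>C. z < 0 \<longrightarrow> n \<noteq> 0 \<and> n * n \<le> n * z" by auto
      \<comment> \<open>For the default point 0 the event \<open>x * x \<le> x * Z t\<close> would
        be the whole space, so its contribution is set to 0.\<close>
      define P where "P x t = (if x = 0 then 0 else emeasure M {\<omega>\<in>space M. x * x \<le> x * Z t \<omega>})" for x t
      have P: "log_limsup_le a at_top (P x) (- m)" if "x \<noteq> 0 \<longrightarrow> x \<in> C" for x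
      proof (cases "x = 0")
        case True
        then show ?thesis by (simp add: P_def log_limsup_le_def)
      next
        case False
        then have "P x = (\<lambda>t. emeasure M {\<omega>\<in>space M. x * x \<le> x * Z t \<omega>})"
          by (auto simp: P_def)
        with False that half_line[of x m] mI show ?thesis by auto
      qed
      have "log_limsup_le a at_top (\<lambda>t. P p t + P n t) (- m)"
        using a P[OF p(1)] P[OF n(1)] by (rule log_limsup_le_add)
      from log_limsup_leD[OF this] m(1)
      have "\<forall>\<^sub>F t in at_top. P p t + P n t \<le> ennreal (exp (b / a t))" by simp
      with ev_meas show ?thesis
      proof eventually_elim
        case (elim t)
        note [measurable] = elim(1)
        let ?S = "\<lambda>x. {\<omega>\<in>space M. x \<noteq> 0 \<and> x * x \<le> x * Z t \<omega>}"
        have "emeasure M {\<omega>\<in>space M. Z t \<omega> \<in> C} \<le> emeasure M (?S p \<union> ?S n)"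
        proof (rule emeasure_mono)
          show "{\<omega> \<in> space M. Z t \<omega> \<in> C} \<subseteq> ?S p \<union> ?S n"
          proof
            fix \<omega> assume \<omega>: "\<omega> \<in> {\<omega>\<in>space M. Z t \<omega> \<in> C}"
            then have "Z t \<omega> \<noteq> 0" using False by auto
            then consider "0 < Z t \<omega>" | "Z t \<omega> < 0" by linarith
            then show "\<omega> \<in> ?S p \<union> ?S n"
              using \<omega> p(2) n(2) by cases auto
          qed
        qed measurable
        also have "\<dots> \<le> emeasure M (?S p) + emeasure M (?S n)"
          by (intro emeasure_subadditive) measurable
        also have "\<dots> = P p t + P n t" by (auto simp: P_def)
        also note elim(2)
        finally show ?case .
      qed
    qed
    with apos show "\<forall>\<^sub>F t in at_top. ereal (a t) * log_prob (\<P>(\<omega> in M. Z t \<omega> \<in> C)) < y"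
    proof eventually_elim
      case (elim t)
      then have "prob {\<omega>\<in>space M. Z t \<omega> \<in> C} \<le> exp (b / a t)"
        by (simp add: emeasure_eq_measure)
      from ereal_mult_log_prob_le[OF elim(1) _ this] b(2) show ?case
        by (auto intro: le_less_trans)
    qed
  qed
  have "open": "- (INF x\<in>U. I x) \<le> Liminf at_top (\<lambda>t. ereal (a t) * log_prob (\<P>(\<omega> in M. Z t \<omega> \<in> U)))"
    if "open U" for U
    unfolding le_Liminf_iff
  proof (intro allI impI)
    fix y assume "y < - (INF x\<in>U. I x)"
    then have "(INF x\<in>U. I x) < - y" by (simp add: ereal_less_uminus_reorder)
    then obtain x where x: "x \<in> U" "I x < - y" by (auto simp: INF_less_iff)
    then have "I x \<noteq> \<infinity>" by auto
    from fin[OF this] obtain \<theta> where \<theta>: "(\<Lambda> has_real_derivative x) (at \<theta>)" "I x = ereal (\<theta> * x - \<Lambda> \<theta>)"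
      by blast
    have "y < - I x" using x(2) by (simp add: ereal_less_uminus_reorder)
    then have "y < ereal (\<Lambda> \<theta> - \<theta> * x)" by (simp add: \<theta>(2))
    then obtain b where b: "y < ereal b" "b < \<Lambda> \<theta> - \<theta> * x"
      by (metis ereal_dense2 less_ereal.simps(1))
    obtain \<epsilon> where \<epsilon>: "\<epsilon> > 0" "ball x \<epsilon> \<subseteq> U" using \<open>open U\<close> x(1) openE by blast
    have "log_liminf_ge a at_top (\<lambda>t. emeasure M {\<omega>\<in>space M. \<bar>Z t \<omega> - x\<bar> < \<epsilon>}) (\<Lambda> \<theta> - \<theta> * x)"
      by (rule log_liminf_ge_ball[OF a ev_meas lower _ \<theta>(1) \<epsilon>(1)]) (use upper in simp)
    from log_liminf_geD[OF this b(2)] apos ev_meas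
    show "\<forall>\<^sub>F t in at_top. y < ereal (a t) * log_prob (\<P>(\<omega> in M. Z t \<omega> \<in> U))"
    proof eventually_elim
      case (elim t)
      note [measurable] = elim(3)
      have [measurable]: "U \<in> sets borel" using \<open>open U\<close> by simp
      have "exp (b / a t) \<le> prob {\<omega>\<in>space M. \<bar>Z t \<omega> - x\<bar> < \<epsilon>}"
        using elim(1) by (simp add: emeasure_eq_measure)
      also have "\<dots> \<le> prob {\<omega>\<in>space M. Z t \<omega> \<in> U}"
        using \<epsilon>(2) by (intro finite_measure_mono) (auto simp: dist_real_def abs_minus_commute)
      finally have "ereal b \<le> ereal (a t) * log_prob (prob {\<omega>\<in>space M. Z t \<omega> \<in> U})"
        by (rule ereal_mult_log_prob_ge[OF elim(2)])
      with b(1) show ?case by (rule less_le_trans)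
    qed
  qed
  have "filterlim (\<lambda>t. 1 / a t) at_top at_top"
    using filterlim_compose[OF filterlim_inverse_at_top_right a] by (simp add: inverse_eq_divide)
  with closed "open" rate meas show ?thesis
    unfolding satisfies_LDP_def by simp
qed

text \<open>Compact level sets are closed, which is lower semicontinuity at levels
  \<open>y \<ge> 0\<close>; for negative levels it follows from \<open>I \<ge> 0\<close>.\<close>

lemma good_rate_functionI:
  assumes nonneg: "\<And>x. 0 \<le> I x"
    and compact: "\<And>\<beta>::real. 0 \<le> \<beta> \<Longrightarrow> compact {x. I x \<le> ereal \<beta>}"
  shows "good_rate_function I"
  unfolding good_rate_function_def rate_function_def lower_semicontinuous_def le_Liminf_iff
proof (intro conjI allI impI nonneg compact)
  fix x y assume "y < I x"
  show "\<forall>\<^sub>F z in at x. y < I z"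
  proof (cases "0 \<le> y")
    case True
    with \<open>y < I x\<close> obtain \<beta> where \<beta>: "y = ereal \<beta>" "0 \<le> \<beta>" by (cases y) auto
    have "open (- {z. I z \<le> y})"
      using compact[OF \<beta>(2)] \<beta>(1) by (auto intro: compact_imp_closed)
    moreover have "x \<in> - {z. I z \<le> y}" using \<open>y < I x\<close> by auto
    ultimately have "\<forall>\<^sub>F z in at x. z \<in> - {z. I z \<le> y}"
      by (rule topological_tendstoD[OF tendsto_ident_at])
    then show ?thesis by eventually_elim auto
  next
    case False
    then have "y < I z" for z using nonneg[of z] by (meson less_le_trans not_le)
    then show ?thesis by simp
  qed
qed

section \<open>Exponential moments of the inverse stable subordinator\<close>

context prob_space
begin

lemma stable_subordinator_measurable:
  assumes "stable_subordinator \<nu> D" "0 \<le> s"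
  shows "D s \<in> borel_measurable M"
  using assms by (auto simp: stable_subordinator_def levy_process_def)

lemma stable_subordinator_laplace:
  assumes D: "stable_subordinator \<nu> D" and "0 \<le> s" "0 \<le> \<xi>"
  shows "(\<integral>\<^sup>+\<omega>. ennreal (exp (- \<xi> * D s \<omega>)) \<partial>M) = ennreal (exp (- s * \<xi> powr \<nu>))"
proof -
  have e: "expectation (\<lambda>\<omega>. exp (- \<xi> * D s \<omega>)) = exp (- s * \<xi> powr \<nu>)"
    using assms by (auto simp: stable_subordinator_def)
  \<comment> \<open>A non-integrable function has Bochner integral 0, while the prescribed value is
    positive; integrability follows.\<close>
  then have "integrable M (\<lambda>\<omega>. exp (- \<xi> * D s \<omega>))"
    using not_integrable_integral_eq by fastforce
  then show ?thesis
    by (subst nn_integral_eq_integral) (use e in auto)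
qed

lemma stable_subordinator_le:
  assumes D: "stable_subordinator \<nu> D" and "0 \<le> s" "0 \<le> \<xi>"
  shows "emeasure M {\<omega>\<in>space M. D s \<omega> \<le> t} \<le> ennreal (exp (\<xi> * t - s * \<xi> powr \<nu>))"
proof -
  note [measurable] = stable_subordinator_measurable[OF D \<open>0 \<le> s\<close>]
  have "emeasure M {\<omega>\<in>space M. D s \<omega> \<le> t} \<le> emeasure M {\<omega>\<in>space M. - \<xi> * t \<le> - \<xi> * D s \<omega>}"
    using \<open>0 \<le> \<xi>\<close> by (intro emeasure_mono) (auto intro: mult_left_mono)
  also have "\<dots> \<le> ennreal (exp (- (- \<xi> * t) / 1)) * (\<integral>\<^sup>+\<omega>. ennreal (exp (- \<xi> * D s \<omega> / 1)) \<partial>M)"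
    by (intro chernoff_emeasure) auto
  also have "\<dots> = ennreal (exp (\<xi> * t)) * ennreal (exp (- s * \<xi> powr \<nu>))"
    using stable_subordinator_laplace[OF assms] by simp
  also have "\<dots> = ennreal (exp (\<xi> * t - s * \<xi> powr \<nu>))"
    by (simp add: ennreal_mult[symmetric] exp_add[symmetric])
  finally show ?thesis .
qed

text \<open>Makes the set in the infimum that defines the inverse subordinator nonempty. Chernoff's
  bound with parameter 1 at integer times gives \<open>exp (t - real n)\<close>, which tends to
  0.\<close>

lemma AE_stable_subordinator_unbounded:
  assumes D: "stable_subordinator \<nu> D"
  shows "AE \<omega> in M. \<exists>s\<ge>0. t < D s \<omega>"
proof -
  note [measurable] = stable_subordinator_measurable[OF D]
  let ?N = "{\<omega>\<in>space M. \<forall>n::nat. D (real n) \<omega> \<le> t}"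
  have N: "?N \<in> sets M" by measurable
  have "prob ?N \<le> exp (t - real n)" for n
  proof -
    have "emeasure M ?N \<le> emeasure M {\<omega>\<in>space M. D (real n) \<omega> \<le> t}"
      by (intro emeasure_mono) auto
    also have "\<dots> \<le> ennreal (exp (t - real n))"
      using stable_subordinator_le[OF D, of "real n" 1 t] by simp
    finally show ?thesis by (simp add: emeasure_eq_measure)
  qed
  moreover have "(\<lambda>n. exp (t - real n)) \<longlonglongrightarrow> 0"
  proof -
    have "(\<lambda>n. exp t * exp (- 1) ^ n) \<longlonglongrightarrow> exp t * 0"
      by (intro tendsto_mult_left LIMSEQ_realpow_zero) auto
    then show ?thesis by (simp add: exp_of_nat_mult[symmetric] exp_add[symmetric])
  qed
  ultimately have "prob ?N \<le> 0"
    by (intro LIMSEQ_le_const) auto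
  then have "emeasure M ?N = 0" by (simp add: emeasure_eq_measure measure_le_0_iff)
  then have "AE \<omega> in M. \<omega> \<notin> ?N"
    using N by (intro AE_not_in) (auto intro: null_setsI)
  with AE_space show ?thesis
  proof eventually_elim
    case (elim \<omega>)
    then obtain n :: nat where "t < D (real n) \<omega>" by (auto simp: not_le)
    then show ?case by (intro exI[of _ "real n"]) auto
  qed
qed

text \<open>Through the two implications, events of \<open>L\<close> are compared with events of
  \<open>D\<close>. The first is the lower bound property of the infimum, the second holds because
  paths of \<open>D\<close> are monotone. The null set depends on \<open>t\<close>, as unboundedness
  of \<open>D\<close> is established one level at a time.\<close>

lemma inverse_stable_subordinatorE:
  assumes "inverse_stable_subordinator \<nu> L"
  obtains D where "stable_subordinator \<nu> D"
    and "\<And>t. 0 \<le> t \<Longrightarrow> AE \<omega> in M. 0 \<le> L t \<omega> \<and>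
      (\<forall>s\<ge>0. s < L t \<omega> \<longrightarrow> D s \<omega> \<le> t) \<and> (\<forall>s\<ge>0. D s \<omega> \<le> t \<longrightarrow> s \<le> L t \<omega>)"
proof -
  from assms obtain D where D: "stable_subordinator \<nu> D"
    and L: "AE \<omega> in M. \<forall>t\<ge>0. L t \<omega> = Inf {s. 0 \<le> s \<and> t < D s \<omega>}"
    by (auto simp: inverse_stable_subordinator_def)
  have mono: "AE \<omega> in M. mono_on {0..} (\<lambda>s. D s \<omega>)"
    using D by (auto simp: stable_subordinator_def)
  have "AE \<omega> in M. 0 \<le> L t \<omega> \<and>
      (\<forall>s\<ge>0. s < L t \<omega> \<longrightarrow> D s \<omega> \<le> t) \<and> (\<forall>s\<ge>0. D s \<omega> \<le> t \<longrightarrow> s \<le> L t \<omega>)" if "0 \<le> t" for t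
    using L mono AE_stable_subordinator_unbounded[OF D, of t]
  proof eventually_elim
    case (elim \<omega>)
    let ?S = "{s. 0 \<le> s \<and> t < D s \<omega>}"
    have L: "L t \<omega> = Inf ?S" using elim(1) that by simp
    have ne: "?S \<noteq> {}" using elim(3) by auto
    have bdd: "bdd_below ?S" by (intro bdd_belowI[of _ 0]) auto
    show ?case
      unfolding L
    proof (intro conjI allI impI)
      show "0 \<le> Inf ?S" using ne by (intro cInf_greatest) auto
      fix s :: real assume "0 \<le> s"
      show "D s \<omega> \<le> t" if "s < Inf ?S"
        using cInf_lower[OF _ bdd, of s] that \<open>0 \<le> s\<close> by fastforce
      assume "D s \<omega> \<le> t"
      show "s \<le> Inf ?S"
      proof (rule cInf_greatest[OF ne])
        fix u assume u: "u \<in> ?S"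
        show "s \<le> u"
        proof (rule ccontr)
          assume "\<not> s \<le> u"
          then have "D u \<omega> \<le> D s \<omega>" using elim(2) u \<open>0 \<le> s\<close> by (auto simp: mono_on_def)
          with \<open>D s \<omega> \<le> t\<close> u show False by auto
        qed
      qed
    qed
  qed
  with D show thesis using that by blast
qed

lemma inverse_stable_subordinator_measurable:
  assumes "inverse_stable_subordinator \<nu> L" "0 \<le> t"
  shows "L t \<in> borel_measurable M"
  using assms by (auto simp: inverse_stable_subordinator_def)

lemma AE_inverse_stable_subordinator_nonneg:
  assumes "inverse_stable_subordinator \<nu> L" "0 \<le> t"
  shows "AE \<omega> in M. 0 \<le> L t \<omega>"
proof -
  from inverse_stable_subordinatorE[OF assms(1)] obtain D where
    "\<And>t. 0 \<le> t \<Longrightarrow> AE \<omega> in M. 0 \<le> L t \<omega> \<and>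
      (\<forall>s\<ge>0. s < L t \<omega> \<longrightarrow> D s \<omega> \<le> t) \<and> (\<forall>s\<ge>0. D s \<omega> \<le> t \<longrightarrow> s \<le> L t \<omega>)" by blast
  from this[OF assms(2)] show ?thesis by eventually_elim auto
qed

lemma inverse_stable_subordinator_tail:
  assumes L: "inverse_stable_subordinator \<nu> L" and "0 \<le> t" "0 \<le> s" "0 \<le> \<xi>"
  shows "emeasure M {\<omega>\<in>space M. s < L t \<omega>} \<le> ennreal (exp (\<xi> * t - s * \<xi> powr \<nu>))"
proof -
  from inverse_stable_subordinatorE[OF L] obtain D where D: "stable_subordinator \<nu> D" and
    AE: "\<And>t. 0 \<le> t \<Longrightarrow> AE \<omega> in M. 0 \<le> L t \<omega> \<and>
      (\<forall>s\<ge>0. s < L t \<omega> \<longrightarrow> D s \<omega> \<le> t) \<and> (\<forall>s\<ge>0. D s \<omega> \<le> t \<longrightarrow> s \<le> L t \<omega>)" by blast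
  note [measurable] = stable_subordinator_measurable[OF D \<open>0 \<le> s\<close>]
    inverse_stable_subordinator_measurable[OF L \<open>0 \<le> t\<close>]
  have "emeasure M {\<omega>\<in>space M. s < L t \<omega>} \<le> emeasure M {\<omega>\<in>space M. D s \<omega> \<le> t}"
    using AE[OF \<open>0 \<le> t\<close>] \<open>0 \<le> s\<close> by (intro emeasure_mono_AE) (auto elim!: AE_mp)
  also note stable_subordinator_le[OF D \<open>0 \<le> s\<close> \<open>0 \<le> \<xi>\<close>]
  finally show ?thesis .
qed

text \<open>On the slice \<open>n < \<theta> * Y \<le> n + 1\<close> the integrand is at most
  \<open>exp (n + 1)\<close>, and the tail bound turns the sum over slices into a geometric series
  of ratio \<open>exp (1 - \<beta> / \<theta>) < 1\<close>; the leading 1 accounts for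
  \<open>Y = 0\<close>. The bound depends on \<open>\<beta>\<close> and \<open>\<theta>\<close> only
  through their quotient, hence is unaffected by a common scale factor.\<close>

lemma nn_integral_exp_le_of_tail:
  assumes [measurable]: "Y \<in> borel_measurable M"
    and nonneg: "AE \<omega> in M. 0 \<le> Y \<omega>"
    and \<theta>: "0 < \<theta>" "\<theta> < \<beta>" and "0 \<le> A"
    and tail: "\<And>s. 0 \<le> s \<Longrightarrow> emeasure M {\<omega>\<in>space M. s < Y \<omega>} \<le> ennreal (A * exp (- \<beta> * s))"
  shows "(\<integral>\<^sup>+\<omega>. ennreal (exp (\<theta> * Y \<omega>)) \<partial>M) \<le> ennreal (1 + A * (exp 1 / (1 - exp (1 - \<beta> / \<theta>))))"
proof -
  define q where "q = exp (1 - \<beta> / \<theta>)"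
  have q: "0 < q" "q < 1" using \<theta> by (auto simp: q_def)
  have "(\<integral>\<^sup>+\<omega>. ennreal (exp (\<theta> * Y \<omega>)) \<partial>M) \<le>
    (\<integral>\<^sup>+\<omega>. 1 + (\<Sum>n. ennreal (exp (real n + 1)) * indicator {\<omega>\<in>space M. real n / \<theta> < Y \<omega>} \<omega>) \<partial>M)"
    using nonneg
  proof (intro nn_integral_mono_AE, elim AE_mp, intro AE_I2 impI)
    fix \<omega> assume \<omega>: "\<omega> \<in> space M" "0 \<le> Y \<omega>"
    define f where "f n = ennreal (exp (real n + 1)) * indicator {\<omega>\<in>space M. real n / \<theta> < Y \<omega>} \<omega>" for n
    have "ennreal (exp (\<theta> * Y \<omega>)) \<le> 1 + (\<Sum>n. f n)"
    proof (cases "Y \<omega> = 0")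
      case False
      with \<omega> \<theta> have "0 < \<theta> * Y \<omega>" by simp
      \<comment> \<open>Ceiling minus one rather than the floor, because the tail event is a strict
        inequality.\<close>
      define n where "n = nat (\<lceil>\<theta> * Y \<omega>\<rceil> - 1)"
      have n: "real n < \<theta> * Y \<omega>" "\<theta> * Y \<omega> \<le> real n + 1"
        using \<open>0 < \<theta> * Y \<omega>\<close> unfolding n_def by linarith+
      have "ennreal (exp (\<theta> * Y \<omega>)) \<le> ennreal (exp (real n + 1))"
        using n by (intro ennreal_leI) simp
      also have "\<dots> = f n"
        using n \<omega> \<theta> by (simp add: f_def field_simps)
      also have "\<dots> \<le> (\<Sum>n. f n)"
        using sum_le_suminf[of f "{n}"] by simp
      finally show ?thesis by (simp add: add_increasing)
    qed simp
    then show "ennreal (exp (\<theta> * Y \<omega>)) \<le> 1 + (\<Sum>n. ennreal (exp (real n + 1)) *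
        indicator {\<omega>\<in>space M. real n / \<theta> < Y \<omega>} \<omega>)"
      unfolding f_def .
  qed
  also have "\<dots> = 1 + (\<Sum>n. ennreal (exp (real n + 1)) * emeasure M {\<omega>\<in>space M. real n / \<theta> < Y \<omega>})"
    by (simp add: nn_integral_add nn_integral_suminf nn_integral_cmult_indicator emeasure_space_1)
  also have "\<dots> \<le> 1 + (\<Sum>n. ennreal (A * exp 1 * q ^ n))"
  proof (intro add_left_mono suminf_le allI)
    fix n :: nat
    have "ennreal (exp (real n + 1)) * emeasure M {\<omega>\<in>space M. real n / \<theta> < Y \<omega>}
      \<le> ennreal (exp (real n + 1)) * ennreal (A * exp (- \<beta> * (real n / \<theta>)))"
      using \<theta> by (intro mult_left_mono tail) auto
    also have "\<dots> = ennreal (A * exp 1 * q ^ n)"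
      using \<open>0 \<le> A\<close> by (simp add: q_def ennreal_mult[symmetric] exp_of_nat_mult[symmetric] exp_add[symmetric] algebra_simps)
    finally show "ennreal (exp (real n + 1)) * emeasure M {\<omega>\<in>space M. real n / \<theta> < Y \<omega>}
      \<le> ennreal (A * exp 1 * q ^ n)" .
  qed auto
  also have "(\<Sum>n. ennreal (A * exp 1 * q ^ n)) = ennreal (A * exp 1 * (1 / (1 - q)))"
    using q \<open>0 \<le> A\<close> by (intro suminf_ennreal_eq sums_mult geometric_sums) auto
  also have "1 + \<dots> = ennreal (1 + A * (exp 1 / (1 - q)))"
    using q \<open>0 \<le> A\<close> by (simp add: ennreal_plus[symmetric] del: ennreal_plus flip: ennreal_1)
  finally show ?thesis by (simp add: q_def)
qed

text \<open>Chernoff's bound with parameter \<open>w / (a t * t)\<close> bounds the tail of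
  \<open>L t\<close> by \<open>exp (w / a t)\<close> times an exponential of rate
  \<open>w powr \<nu> * (a t * t) powr - \<nu>\<close>. As soon as \<open>w powr \<nu>\<close>
  exceeds the limit of \<open>r\<close>, the moment is at most a constant times
  \<open>exp (w / a t)\<close>, and \<open>w\<close> may be taken arbitrarily close to the claimed
  value.\<close>

lemma log_limsup_le_exp_inverse_stable_subordinator:
  assumes L: "inverse_stable_subordinator \<nu> L" and nu: "0 < \<nu>"
    and a_pos: "\<And>t. t > 0 \<Longrightarrow> a t > 0" and a_lim: "(a \<longlongrightarrow> 0) at_top"
    and r: "(r \<longlongrightarrow> r0) at_top"
  shows "log_limsup_le a at_top
    (\<lambda>t. \<integral>\<^sup>+\<omega>. ennreal (exp (r t * (a t * t) powr - \<nu> * L t \<omega>)) \<partial>M) (max r0 0 powr (1 / \<nu>))"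
  unfolding log_limsup_le_def
proof (intro allI impI)
  fix b assume "max r0 0 powr (1 / \<nu>) < b"
  then obtain w where w: "max r0 0 powr (1 / \<nu>) < w" "w < b" using dense by blast
  have "0 < w" using w(1) by (rule le_less_trans[rotated]) simp
  have a: "filterlim a (at_right 0) at_top"
    by (rule filterlim_at_right_0_at_topI[OF a_pos a_lim])
  have "max r0 0 = (max r0 0 powr (1 / \<nu>)) powr \<nu>" using nu by (simp add: powr_powr)
  also have "\<dots> < w powr \<nu>" using w(1) nu by (intro powr_less_mono2) auto
  \<comment> \<open>\<open>\<rho>\<close> eventually dominates \<open>r t\<close> and is positive
    even if \<open>r0\<close> is not, as the tail-to-moment bound requires.\<close>
  finally obtain \<rho> where \<rho>: "max r0 0 < \<rho>" "\<rho> < w powr \<nu>" using dense by blast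
  define K where "K = exp 1 / (1 - exp (1 - w powr \<nu> / \<rho>))"
  have "0 < \<rho>" using \<rho>(1) by auto
  have "0 \<le> K" unfolding K_def using \<rho> \<open>0 < \<rho>\<close> by simp
  have "\<forall>\<^sub>F t in at_top. r t < \<rho>" using r \<rho>(1) by (auto intro: order_tendstoD)
  with eventually_gt_at_top[of 0] eventually_mult_exp_le[OF a w(2), of "1 + K"]
  show "\<forall>\<^sub>F t in at_top. (\<integral>\<^sup>+\<omega>. ennreal (exp (r t * (a t * t) powr - \<nu> * L t \<omega>)) \<partial>M) \<le> ennreal (exp (b / a t))"
  proof eventually_elim
    case (elim t)
    have at: "0 < a t" using elim(1) a_pos by simp
    define \<kappa> where "\<kappa> = (a t * t) powr - \<nu>"
    have "0 < \<kappa>" using at elim(1) by (simp add: \<kappa>_def)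
    have [measurable]: "L t \<in> borel_measurable M"
      using inverse_stable_subordinator_measurable[OF L] elim(1) by simp
    have nonneg: "AE \<omega> in M. 0 \<le> L t \<omega>"
      using AE_inverse_stable_subordinator_nonneg[OF L] elim(1) by simp
    have "(\<integral>\<^sup>+\<omega>. ennreal (exp (r t * \<kappa> * L t \<omega>)) \<partial>M) \<le> (\<integral>\<^sup>+\<omega>. ennreal (exp (\<rho> * \<kappa> * L t \<omega>)) \<partial>M)"
      using nonneg
    proof (intro nn_integral_mono_AE, eventually_elim)
      case (elim \<omega>)
      then show ?case using \<open>r t < \<rho>\<close> \<open>0 < \<kappa>\<close>
        by (intro ennreal_leI) (auto intro!: mult_right_mono)
    qed
    also have "\<dots> \<le> ennreal (1 + exp (w / a t) * (exp 1 / (1 - exp (1 - (w powr \<nu> * \<kappa>) / (\<rho> * \<kappa>)))))"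
    proof (intro nn_integral_exp_le_of_tail nonneg)
      fix s :: real assume "0 \<le> s"
      have "emeasure M {\<omega>\<in>space M. s < L t \<omega>} \<le> ennreal (exp (w / (a t * t) * t - s * (w / (a t * t)) powr \<nu>))"
        using \<open>0 < w\<close> at elim(1) \<open>0 \<le> s\<close> by (intro inverse_stable_subordinator_tail[OF L]) auto
      also have "w / (a t * t) * t = w / a t" using elim(1) by simp
      also have "(w / (a t * t)) powr \<nu> = w powr \<nu> * \<kappa>"
        using \<open>0 < w\<close> at elim(1) by (subst powr_divide) (auto simp: \<kappa>_def powr_minus divide_inverse)
      also have "exp (w / a t - s * (w powr \<nu> * \<kappa>)) = exp (w / a t) * exp (- (w powr \<nu> * \<kappa>) * s)"
        by (simp add: exp_add[symmetric] mult_ac)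
      finally show "emeasure M {\<omega>\<in>space M. s < L t \<omega>} \<le> ennreal (exp (w / a t) * exp (- (w powr \<nu> * \<kappa>) * s))" .
    qed (use \<open>0 < \<rho>\<close> \<rho> \<open>0 < \<kappa>\<close> in auto)
    also have "\<dots> = ennreal (1 + exp (w / a t) * K)"
      using \<open>0 < \<kappa>\<close> by (simp add: K_def)
    also have "\<dots> \<le> ennreal ((1 + K) * exp (w / a t))"
      using \<open>0 < w\<close> at by (intro ennreal_leI) (simp add: algebra_simps)
    also have "\<dots> \<le> ennreal (exp (b / a t))"
      using elim(2) by (rule ennreal_leI)
    finally show ?case by (simp add: \<kappa>_def)
  qed
qed

text \<open>For \<open>s t = c * (a t * t) powr \<nu> / a t\<close> the event
  \<open>D (s t) \<le> t\<close> contributes the exponent \<open>r0 * c\<close> from the integrand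
  and \<open>\<xi> - c * \<xi> powr \<nu>\<close> from its probability, where
  \<open>c * \<nu> * \<xi> powr (\<nu> - 1) = 1\<close>. Optimality in \<open>c\<close> forces
  \<open>\<xi> powr \<nu> = r0\<close>; then the terms with \<open>c\<close> cancel and
  \<open>\<xi> = r0 powr (1 / \<nu>)\<close> remains.\<close>

lemma log_liminf_ge_exp_inverse_stable_subordinator_pos:
  assumes L: "inverse_stable_subordinator \<nu> L" and nu: "0 < \<nu>"
    and a_pos: "\<And>t. t > 0 \<Longrightarrow> a t > 0" and a_lim: "(a \<longlongrightarrow> 0) at_top"
    and r: "(r \<longlongrightarrow> r0) at_top" and "0 < r0"
  shows "log_liminf_ge a at_top
    (\<lambda>t. \<integral>\<^sup>+\<omega>. ennreal (exp (r t * (a t * t) powr - \<nu> * L t \<omega>)) \<partial>M) (r0 powr (1 / \<nu>))"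
  unfolding log_liminf_ge_def
proof (intro allI impI)
  fix b assume b: "b < r0 powr (1 / \<nu>)"
  have a: "filterlim a (at_right 0) at_top"
    by (rule filterlim_at_right_0_at_topI[OF a_pos a_lim])
  define \<xi> where "\<xi> = r0 powr (1 / \<nu>)"
  have \<xi>: "0 < \<xi>" "\<xi> powr \<nu> = r0" "b < \<xi>"
    using \<open>0 < r0\<close> nu b by (auto simp: \<xi>_def powr_powr)
  \<comment> \<open>With \<open>c = c0\<close> the tilt \<open>- \<xi>\<close> would give
    \<open>D (s t) / t\<close> asymptotic mean 1.\<close>
  define c0 where "c0 = \<xi> powr (1 - \<nu>) / \<nu>"
  have "0 < c0" using \<xi> nu by (simp add: c0_def)
  \<comment> \<open>The target is \<open>1 - \<delta>\<close> instead of 1, so that the ball of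
    radius \<open>\<delta>\<close> around it lies in \<open>D (s t) < t\<close>. Moving the target
    and replacing \<open>r t\<close> by \<open>r0 - \<delta>\<close> together lose at most
    \<open>\<delta> * (c0 + \<xi>)\<close> in the exponent.\<close>
  obtain \<delta> where \<delta>: "0 < \<delta>" "\<delta> < 1" "\<delta> < r0" "\<delta> * (c0 + \<xi>) < \<xi> - b"
  proof -
    define \<delta> where "\<delta> = min (min (1 / 2) (r0 / 2)) ((\<xi> - b) / (2 * (c0 + \<xi>)))"
    have "\<delta> * (c0 + \<xi>) \<le> (\<xi> - b) / (2 * (c0 + \<xi>)) * (c0 + \<xi>)"
      using \<open>0 < c0\<close> \<xi> by (intro mult_right_mono) (auto simp: \<delta>_def)
    also have "\<dots> = (\<xi> - b) / 2" using \<open>0 < c0\<close> \<xi> by (simp add: field_simps)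
    also have "\<dots> < \<xi> - b" using \<xi> by simp
    finally show ?thesis
      using \<open>0 < r0\<close> \<open>0 < c0\<close> \<xi> by (intro that[of \<delta>]) (auto simp: \<delta>_def)
  qed
  define c where "c = (1 - \<delta>) * c0"
  have c: "0 < c" "c \<le> c0" using \<delta> \<open>0 < c0\<close> by (auto simp: c_def)
  from inverse_stable_subordinatorE[OF L] obtain D where D: "stable_subordinator \<nu> D" and
    AE: "\<And>t. 0 \<le> t \<Longrightarrow> AE \<omega> in M. 0 \<le> L t \<omega> \<and>
      (\<forall>s\<ge>0. s < L t \<omega> \<longrightarrow> D s \<omega> \<le> t) \<and> (\<forall>s\<ge>0. D s \<omega> \<le> t \<longrightarrow> s \<le> L t \<omega>)" by blast
  define s where "s t = c * (a t * t) powr \<nu> / a t" for t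
  have s: "0 \<le> s t" if "0 < t" for t using c a_pos[OF that] by (auto simp: s_def)
  define \<Lambda> where "\<Lambda> \<eta> = - c * (- \<eta>) powr \<nu>" for \<eta>
  \<comment> \<open>The time scale \<open>s t\<close> makes the cumulant of
    \<open>D (s t) / t\<close> exact rather than asymptotic. The formula is for negative arguments,
    which fill a neighborhood of the tilt \<open>- \<xi>\<close>.\<close>
  have laplace: "(\<integral>\<^sup>+\<omega>. ennreal (exp (\<eta> * (D (s t) \<omega> / t) / a t)) \<partial>M) = ennreal (exp (\<Lambda> \<eta> / a t))"
    if "0 < t" "\<eta> < 0" for t \<eta>
  proof -
    have "(\<integral>\<^sup>+\<omega>. ennreal (exp (\<eta> * (D (s t) \<omega> / t) / a t)) \<partial>M)
        = (\<integral>\<^sup>+\<omega>. ennreal (exp (- (- \<eta> / (a t * t)) * D (s t) \<omega>)) \<partial>M)"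
      by (simp add: mult_ac)
    also have "\<dots> = ennreal (exp (- s t * (- \<eta> / (a t * t)) powr \<nu>))"
      using that a_pos[OF that(1)] s by (intro stable_subordinator_laplace[OF D]) (auto simp: divide_le_0_iff)
    also have "- s t * (- \<eta> / (a t * t)) powr \<nu> = \<Lambda> \<eta> / a t"
      using that a_pos[OF that(1)]
      by (subst powr_divide) (auto simp: s_def \<Lambda>_def)
    finally show ?thesis .
  qed
  have "log_liminf_ge a at_top (\<lambda>t. emeasure M {\<omega>\<in>space M. \<bar>D (s t) \<omega> / t - (1 - \<delta>)\<bar> < \<delta>}) (\<Lambda> (- \<xi>) - (- \<xi>) * (1 - \<delta>))"
  proof (rule log_liminf_ge_ball[OF a _ _ _ _ \<delta>(1)])
    show "\<forall>\<^sub>F t in at_top. (\<lambda>\<omega>. D (s t) \<omega> / t) \<in> borel_measurable M"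
      using eventually_gt_at_top[of 0]
      by eventually_elim (intro borel_measurable_divide borel_measurable_const stable_subordinator_measurable[OF D] s)
    show "log_liminf_ge a at_top (\<lambda>t. \<integral>\<^sup>+\<omega>. ennreal (exp (- \<xi> * (D (s t) \<omega> / t) / a t)) \<partial>M) (\<Lambda> (- \<xi>))"
      unfolding log_liminf_ge_def
    proof (intro allI impI)
      fix b' assume "b' < \<Lambda> (- \<xi>)"
      show "\<forall>\<^sub>F t in at_top. ennreal (exp (b' / a t)) \<le> (\<integral>\<^sup>+\<omega>. ennreal (exp (- \<xi> * (D (s t) \<omega> / t) / a t)) \<partial>M)"
        using eventually_gt_at_top[of 0]
      proof eventually_elim
        case (elim t)
        show ?case
          using \<open>b' < \<Lambda> (- \<xi>)\<close> a_pos[OF elim] \<xi>(1)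
          by (subst laplace[OF elim]) (auto intro!: ennreal_leI divide_right_mono)
      qed
    qed
    have "\<forall>\<^sub>F \<eta> in nhds (- \<xi>). \<eta> < 0"
      using \<xi>(1) by (intro eventually_nhds_in_open[of "{..<0}", simplified]) auto
    then show "\<forall>\<^sub>F \<eta> in nhds (- \<xi>). log_limsup_le a at_top
        (\<lambda>t. \<integral>\<^sup>+\<omega>. ennreal (exp (\<eta> * (D (s t) \<omega> / t) / a t)) \<partial>M) (\<Lambda> \<eta>)"
    proof eventually_elim
      case \<eta>: (elim \<eta>)
      show ?case
        unfolding log_limsup_le_def
      proof (intro allI impI)
        fix b' assume "\<Lambda> \<eta> < b'"
        show "\<forall>\<^sub>F t in at_top. (\<integral>\<^sup>+\<omega>. ennreal (exp (\<eta> * (D (s t) \<omega> / t) / a t)) \<partial>M) \<le> ennreal (exp (b' / a t))"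
          using eventually_gt_at_top[of 0]
        proof eventually_elim
          case (elim t)
          show ?case
            using \<open>\<Lambda> \<eta> < b'\<close> a_pos[OF elim] \<eta>
            by (subst laplace[OF elim]) (auto intro!: ennreal_leI divide_right_mono)
        qed
      qed
    qed
    have "\<nu> * \<xi> powr (\<nu> - 1) * c = 1 - \<delta>"
      using nu \<xi>(1) by (simp add: c_def c0_def powr_add[symmetric])
    then show "(\<Lambda> has_real_derivative 1 - \<delta>) (at (- \<xi>))"
      unfolding \<Lambda>_def using \<xi>(1) by (auto intro!: derivative_eq_intros)
  qed
  \<comment> \<open>\<open>g\<close> is the share of the exponent \<open>b\<close> that the
    probability must supply after the integrand has supplied
    \<open>(r0 - \<delta>) * c\<close>.\<close>
  moreover define g where "g = b - (r0 - \<delta>) * c"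
  have "g < \<Lambda> (- \<xi>) - (- \<xi>) * (1 - \<delta>)"
  proof -
    have "\<delta> * c \<le> \<delta> * c0" using c \<delta> by (intro mult_left_mono) auto
    then have "b < \<xi> * (1 - \<delta>) - \<delta> * c" using \<delta>(4) by (simp add: algebra_simps)
    then show ?thesis by (simp add: g_def \<Lambda>_def \<xi>(2) algebra_simps)
  qed
  ultimately have "\<forall>\<^sub>F t in at_top. ennreal (exp (g / a t)) \<le> emeasure M {\<omega>\<in>space M. \<bar>D (s t) \<omega> / t - (1 - \<delta>)\<bar> < \<delta>}"
    by (rule log_liminf_geD)
  moreover have "\<forall>\<^sub>F t in at_top. r0 - \<delta> < r t"
    using r \<delta>(1) by (auto intro: order_tendstoD)
  ultimately show "\<forall>\<^sub>F t in at_top. ennreal (exp (b / a t)) \<le> (\<integral>\<^sup>+\<omega>. ennreal (exp (r t * (a t * t) powr - \<nu> * L t \<omega>)) \<partial>M)"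
    using eventually_gt_at_top[of 0]
  proof eventually_elim
    case (elim t)
    have at: "0 < a t" using elim(3) a_pos by simp
    define \<kappa> where "\<kappa> = (a t * t) powr - \<nu>"
    have "0 < \<kappa>" using at elim(3) by (simp add: \<kappa>_def)
    have \<kappa>s: "\<kappa> * s t = c / a t"
      using at elim(3) by (simp add: \<kappa>_def s_def powr_minus field_simps)
    have [measurable]: "L t \<in> borel_measurable M" "D (s t) \<in> borel_measurable M"
      using inverse_stable_subordinator_measurable[OF L] stable_subordinator_measurable[OF D s] elim(3) by auto
    let ?A = "{\<omega>\<in>space M. \<bar>D (s t) \<omega> / t - (1 - \<delta>)\<bar> < \<delta>}"
    have "ennreal (exp (b / a t)) = ennreal (exp ((r0 - \<delta>) * c / a t)) * ennreal (exp (g / a t))"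
      by (simp add: ennreal_mult[symmetric] exp_add[symmetric] g_def diff_divide_distrib)
    also have "\<dots> \<le> ennreal (exp ((r0 - \<delta>) * c / a t)) * emeasure M ?A"
      using elim(1) by (rule mult_left_mono) simp
    also have "\<dots> = (\<integral>\<^sup>+\<omega>. ennreal (exp ((r0 - \<delta>) * c / a t)) * indicator ?A \<omega> \<partial>M)"
      by (subst nn_integral_cmult_indicator) auto
    also have "\<dots> \<le> (\<integral>\<^sup>+\<omega>. ennreal (exp (r t * \<kappa> * L t \<omega>)) \<partial>M)"
      using AE[OF less_imp_le[OF elim(3)]]
    proof (intro nn_integral_mono_AE, eventually_elim)
      case *: (elim \<omega>)
      show ?case
      proof (cases "\<omega> \<in> ?A")
        case True
        then have "D (s t) \<omega> / t < 1" by auto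
        then have "D (s t) \<omega> \<le> t" using elim(3) by (simp add: field_simps)
        then have "s t \<le> L t \<omega>" using * s[OF elim(3)] by auto
        have "(r0 - \<delta>) * c / a t = (r0 - \<delta>) * \<kappa> * s t" by (simp add: \<kappa>s mult.assoc)
        also have "\<dots> \<le> r t * \<kappa> * L t \<omega>"
          using elim(2) \<open>0 < \<kappa>\<close> \<delta>(3) s[OF elim(3)] \<open>s t \<le> L t \<omega>\<close>
          by (intro mult_mono mult_right_mono mult_nonneg_nonneg) auto
        finally show ?thesis by (auto simp: indicator_def intro!: ennreal_leI)
      qed simp
    qed
    finally show ?case by (simp add: \<kappa>_def)
  qed
qed

text \<open>With probability at least 1/2, \<open>L t\<close> is at most
  \<open>2 * t powr \<nu>\<close>. There the exponent is bounded below by a constant multiple of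
  \<open>- (a t powr - \<nu>)\<close>, which is negligible against \<open>1 / a t\<close> because
  \<open>\<nu> < 1\<close>.\<close>

lemma log_liminf_ge_exp_inverse_stable_subordinator_zero:
  assumes L: "inverse_stable_subordinator \<nu> L" and nu: "\<nu> < 1"
    and a_pos: "\<And>t. t > 0 \<Longrightarrow> a t > 0" and a_lim: "(a \<longlongrightarrow> 0) at_top"
    and r: "(r \<longlongrightarrow> r0) at_top"
  shows "log_liminf_ge a at_top
    (\<lambda>t. \<integral>\<^sup>+\<omega>. ennreal (exp (r t * (a t * t) powr - \<nu> * L t \<omega>)) \<partial>M) 0"
  unfolding log_liminf_ge_def
proof (intro allI impI)
  fix b :: real assume "b < 0"
  have a: "filterlim a (at_right 0) at_top"
    by (rule filterlim_at_right_0_at_topI[OF a_pos a_lim])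
  define k where "k = \<bar>r0\<bar> + 1"
  have "0 < k" by (simp add: k_def)
  have "\<forall>\<^sub>F t in at_top. - k < r t" using r by (rule order_tendstoD) (simp add: k_def)
  \<comment> \<open>This threshold lets the exponent lose at most half of \<open>- b / a t\<close>;
    the other half absorbs the probability factor 1/2.\<close>
  moreover have "\<forall>\<^sub>F t in at_top. a t powr (1 - \<nu>) < - b / (4 * k)"
  proof -
    have "((\<lambda>t. a t powr (1 - \<nu>)) \<longlongrightarrow> 0) at_top"
    proof (rule tendsto_zero_powrI[OF a_lim tendsto_const])
      show "\<forall>\<^sub>F t in at_top. 0 \<le> a t"
        using eventually_gt_at_top[of 0] by eventually_elim (use a_pos in \<open>simp add: less_imp_le\<close>)
    qed (use nu in simp)
    then show ?thesis using \<open>b < 0\<close> \<open>0 < k\<close> by (intro order_tendstoD) (auto simp: field_simps)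
  qed
  moreover have "\<forall>\<^sub>F t in at_top. 2 * exp (b / a t) \<le> exp (b / 2 / a t)"
    using \<open>b < 0\<close> by (intro eventually_mult_exp_le[OF a]) simp
  ultimately show "\<forall>\<^sub>F t in at_top. ennreal (exp (b / a t)) \<le> (\<integral>\<^sup>+\<omega>. ennreal (exp (r t * (a t * t) powr - \<nu> * L t \<omega>)) \<partial>M)"
    using eventually_gt_at_top[of 0]
  proof eventually_elim
    case (elim t)
    have at: "0 < a t" using elim(4) a_pos by simp
    define \<kappa> where "\<kappa> = (a t * t) powr - \<nu>"
    have "0 < \<kappa>" using at elim(4) by (simp add: \<kappa>_def)
    \<comment> \<open>With Chernoff parameter \<open>1 / t\<close> the factor 2 makes the tail bound
      \<open>exp (1 - 2)\<close>, which is at most 1/2.\<close>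
    define s where "s = 2 * t powr \<nu>"
    have "0 \<le> s" by (simp add: s_def)
    have [measurable]: "L t \<in> borel_measurable M"
      using inverse_stable_subordinator_measurable[OF L] elim(4) by auto
    have "emeasure M {\<omega>\<in>space M. s < L t \<omega>} \<le> ennreal (exp (1 / t * t - s * (1 / t) powr \<nu>))"
      using elim(4) \<open>0 \<le> s\<close> by (intro inverse_stable_subordinator_tail[OF L]) auto
    also have "1 / t * t - s * (1 / t) powr \<nu> = - 1"
      using elim(4) by (simp add: s_def powr_divide)
    finally have "prob {\<omega>\<in>space M. s < L t \<omega>} \<le> exp (- 1)"
      by (simp add: emeasure_eq_measure)
    also have "\<dots> \<le> 1 / 2"
      using exp_ge_add_one_self[of 1] by (simp add: exp_minus field_simps)
    finally have half: "1 / 2 \<le> prob {\<omega>\<in>space M. L t \<omega> \<le> s}"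
      using prob_neg[of "\<lambda>\<omega>. s < L t \<omega>"] by (simp add: not_less)
    have "\<kappa> * s * a t = 2 * a t powr (1 - \<nu>)"
      using at elim(4) by (simp add: \<kappa>_def s_def powr_minus powr_mult powr_diff field_simps)
    then have "k * \<kappa> * s * a t = 2 * (k * a t powr (1 - \<nu>))" by (simp add: mult_ac)
    also have "\<dots> \<le> - b / 2" using elim(2) \<open>0 < k\<close> by (simp add: field_simps)
    finally have "k * \<kappa> * s * a t \<le> - b / 2" .
    then have ks: "b / 2 / a t \<le> - (k * \<kappa> * s)"
      using at by (simp add: field_simps)
    let ?A = "{\<omega>\<in>space M. L t \<omega> \<le> s}"
    have "exp (b / a t) \<le> exp (b / 2 / a t) * (1 / 2)" using elim(3) by simp
    also have "\<dots> \<le> exp (b / 2 / a t) * prob ?A" using half by (intro mult_left_mono) auto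
    finally have "ennreal (exp (b / a t)) \<le> ennreal (exp (b / 2 / a t)) * emeasure M ?A"
      by (simp add: emeasure_eq_measure ennreal_mult[symmetric] ennreal_leI)
    also have "\<dots> = (\<integral>\<^sup>+\<omega>. ennreal (exp (b / 2 / a t)) * indicator ?A \<omega> \<partial>M)"
      by (subst nn_integral_cmult_indicator) auto
    also have "\<dots> \<le> (\<integral>\<^sup>+\<omega>. ennreal (exp (r t * \<kappa> * L t \<omega>)) \<partial>M)"
      using AE_inverse_stable_subordinator_nonneg[OF L less_imp_le[OF elim(4)]]
    proof (intro nn_integral_mono_AE, eventually_elim)
      case *: (elim \<omega>)
      show ?case
      proof (cases "\<omega> \<in> ?A")
        case True
        have "b / 2 / a t \<le> - (k * \<kappa> * s)" by fact
        also have "\<dots> \<le> - (k * \<kappa> * L t \<omega>)"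
          using True \<open>0 < k\<close> \<open>0 < \<kappa>\<close> by (auto intro!: mult_left_mono)
        also have "\<dots> \<le> r t * \<kappa> * L t \<omega>"
          using mult_right_mono[of "- k" "r t" "\<kappa> * L t \<omega>"] elim(1) \<open>0 < \<kappa>\<close> * by (simp add: mult.assoc)
        finally show ?thesis by (auto simp: indicator_def intro!: ennreal_leI)
      qed simp
    qed
    finally show ?case by (simp add: \<kappa>_def)
  qed
qed

lemma log_liminf_ge_exp_inverse_stable_subordinator:
  assumes L: "inverse_stable_subordinator \<nu> L" and nu: "0 < \<nu>" "\<nu> < 1"
    and a_pos: "\<And>t. t > 0 \<Longrightarrow> a t > 0" and a_lim: "(a \<longlongrightarrow> 0) at_top"
    and r: "(r \<longlongrightarrow> r0) at_top"
  shows "log_liminf_ge a at_top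
    (\<lambda>t. \<integral>\<^sup>+\<omega>. ennreal (exp (r t * (a t * t) powr - \<nu> * L t \<omega>)) \<partial>M) (max r0 0 powr (1 / \<nu>))"
proof (cases "0 < r0")
  case True
  then show ?thesis
    using log_liminf_ge_exp_inverse_stable_subordinator_pos[OF L nu(1) a_pos a_lim r] by simp
next
  case False
  then show ?thesis
    using log_liminf_ge_exp_inverse_stable_subordinator_zero[OF L nu(2) a_pos a_lim r] by simp
qed

end

section \<open>Exponential moments of the compound process\<close>

lemma (in prob_space) indep_familiesD:
  assumes "indep_families S I Y T J Z"
  shows "indep_set
    (sigma_sets (space M) (\<Union>i\<in>I. {Y i -` A \<inter> space M | A. A \<in> sets S}))
    (sigma_sets (space M) (\<Union>j\<in>J. {Z j -` B \<inter> space M | B. B \<in> sets T}))"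
  using assms by (simp add: indep_families_def)

lemma (in prob_space) indep_families_prob_eq:
  assumes indep: "indep_families S I Y T J Z" and i: "i \<in> I" and j: "j \<in> J"
    and A: "A \<in> sets S" and B: "B \<in> sets T"
  shows "prob {\<omega>\<in>space M. Y i \<omega> \<in> A \<and> Z j \<omega> \<in> B}
    = prob {\<omega>\<in>space M. Y i \<omega> \<in> A} * prob {\<omega>\<in>space M. Z j \<omega> \<in> B}"
proof -
  have "prob ((Y i -` A \<inter> space M) \<inter> (Z j -` B \<inter> space M)) = prob (Y i -` A \<inter> space M) * prob (Z j -` B \<inter> space M)"
    using i j A B by (intro indep_setD[OF indep_familiesD[OF indep]]) auto
  moreover have "(Y i -` A \<inter> space M) \<inter> (Z j -` B \<inter> space M) = {\<omega>\<in>space M. Y i \<omega> \<in> A \<and> Z j \<omega> \<in> B}"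
    "Y i -` A \<inter> space M = {\<omega>\<in>space M. Y i \<omega> \<in> A}" "Z j -` B \<inter> space M = {\<omega>\<in>space M. Z j \<omega> \<in> B}"
    by auto
  ultimately show ?thesis by simp
qed

text \<open>No joint measurability of \<open>N1\<close> in time and \<open>\<omega>\<close> is available, so the random time is replaced by
  a countably valued one approaching it strictly from above, where right continuity applies.\<close>

lemma (in prob_space) emeasure_poisson_process_random_time:
  assumes N1: "poisson_process lambda N1" and "0 < lambda"
    and L: "L t \<in> borel_measurable M" "AE \<omega> in M. 0 \<le> L t \<omega>"
    and indep: "indep_families (count_space UNIV) {0..} N1 borel {0..} L" and "0 \<le> t"
    and N: "N \<in> measurable M (count_space UNIV)" "AE \<omega> in M. N \<omega> = N1 (L t \<omega>) \<omega>"
  shows "emeasure M {\<omega>\<in>space M. N \<omega> = k} =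
    (\<integral>\<^sup>+\<omega>. ennreal (exp (- (lambda * L t \<omega>)) * (lambda * L t \<omega>) ^ k / fact k) \<partial>M)"
proof -
  note [measurable] = L(1) N(1)
  have N1_meas: "N1 u \<in> measurable M (count_space UNIV)" if "0 \<le> u" for u
    using N1 that by (auto simp: poisson_process_def)
  define p where "p u = exp (- (lambda * u)) * (lambda * u) ^ k / fact k" for u :: real
  have p_meas [measurable]: "p \<in> borel_measurable borel" by (simp add: p_def[abs_def])
  have p_eq: "p u = pmf (poisson_pmf (lambda * u)) k" if "0 < u" for u
    using that \<open>0 < lambda\<close> by (simp add: p_def)
  have p_01: "0 \<le> p u" "p u \<le> 1" if "0 < u" for u
    using p_eq[OF that] by (simp_all add: pmf_le_1)
  have prob_N1: "prob {\<omega>\<in>space M. N1 u \<omega> = k} = p u" if "0 < u" for u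
  proof -
    note [measurable] = N1_meas[OF less_imp_le[OF that]]
    have "prob {\<omega>\<in>space M. N1 u \<omega> = k} = measure (distr M (count_space UNIV) (N1 u)) {k}"
      by (subst measure_distr) (auto intro!: arg_cong[where f = prob])
    also have "distr M (count_space UNIV) (N1 u) = measure_pmf (poisson_pmf (lambda * u))"
      using N1 that by (auto simp: poisson_process_def)
    finally show ?thesis using that by (simp add: p_eq measure_pmf_single)
  qed
  define j where "j n \<omega> = nat \<lfloor>real (Suc n) * L t \<omega>\<rfloor>" for n \<omega>
  \<comment> \<open>\<open>j n\<close> rounds down to the grid of mesh \<open>1 / Suc n\<close>, and
    \<open>Suc i\<close> moves on to the next grid point. This gives strictness and keeps all grid
    times positive, where the Poisson law of \<open>N1\<close> is prescribed.\<close>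
  define g where "g n i = real (Suc i) / real (Suc n)" for n i :: nat
  have g: "0 < g n i" for n i by (simp add: g_def)
  have j_meas [measurable]: "j n \<in> measurable M (count_space UNIV)" for n
    unfolding j_def by measurable
  have N1g [measurable]: "N1 (g n i) \<in> measurable M (count_space UNIV)" for n i
    using N1_meas g less_imp_le by blast
  have [measurable]: "(\<lambda>\<omega>. N1 (g n (j n \<omega>)) \<omega>) \<in> measurable M (count_space UNIV)" for n
    by (rule measurable_compose_countable[where g = "j n"]) measurable
  \<comment> \<open>On the event \<open>j n \<omega> = i\<close> the time is the fixed number
    \<open>g n i\<close>, and independence of \<open>N1 (g n i)\<close> and \<open>L t\<close>
    factors the probability.\<close>
  have discr: "(\<integral>\<^sup>+\<omega>. indicator {\<omega>\<in>space M. N1 (g n (j n \<omega>)) \<omega> = k} \<omega> \<partial>M) = (\<integral>\<^sup>+\<omega>. ennreal (p (g n (j n \<omega>))) \<partial>M)" for n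
  proof -
    have "(\<integral>\<^sup>+\<omega>. indicator {\<omega>\<in>space M. N1 (g n (j n \<omega>)) \<omega> = k} \<omega> \<partial>M)
       = emeasure M (\<Union>i. {\<omega>\<in>space M. N1 (g n i) \<omega> = k \<and> j n \<omega> = i})"
      by (subst nn_integral_indicator) (auto intro!: arg_cong[where f = "emeasure M"])
    also have "\<dots> = (\<Sum>i. emeasure M {\<omega>\<in>space M. N1 (g n i) \<omega> = k \<and> j n \<omega> = i})"
      by (subst suminf_emeasure) (auto simp: disjoint_family_on_def)
    also have "\<dots> = (\<Sum>i. ennreal (p (g n i)) * emeasure M {\<omega>\<in>space M. j n \<omega> = i})"
    proof (intro suminf_cong)
      fix i
      have "prob {\<omega>\<in>space M. N1 (g n i) \<omega> \<in> {k} \<and> L t \<omega> \<in> {x. nat \<lfloor>real (Suc n) * x\<rfloor> = i}}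
          = prob {\<omega>\<in>space M. N1 (g n i) \<omega> \<in> {k}} * prob {\<omega>\<in>space M. L t \<omega> \<in> {x. nat \<lfloor>real (Suc n) * x\<rfloor> = i}}"
        using g[of n i] \<open>0 \<le> t\<close> by (intro indep_families_prob_eq[OF indep]) auto
      then show "emeasure M {\<omega>\<in>space M. N1 (g n i) \<omega> = k \<and> j n \<omega> = i} = ennreal (p (g n i)) * emeasure M {\<omega>\<in>space M. j n \<omega> = i}"
        using prob_N1[OF g] p_01[OF g] by (simp add: j_def emeasure_eq_measure ennreal_mult)
    qed
    also have "\<dots> = (\<integral>\<^sup>+\<omega>. (\<Sum>i. ennreal (p (g n i)) * indicator {\<omega>\<in>space M. j n \<omega> = i} \<omega>) \<partial>M)"
      by (simp add: nn_integral_suminf nn_integral_cmult_indicator)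
    also have "\<dots> = (\<integral>\<^sup>+\<omega>. ennreal (p (g n (j n \<omega>))) \<partial>M)"
    proof (intro nn_integral_cong)
      fix \<omega> assume "\<omega> \<in> space M"
      have "(\<Sum>i. ennreal (p (g n i)) * indicator {\<omega>\<in>space M. j n \<omega> = i} \<omega>)
        = (\<Sum>i\<in>{j n \<omega>}. ennreal (p (g n i)) * indicator {\<omega>\<in>space M. j n \<omega> = i} \<omega>)"
        by (intro suminf_finite) (auto simp: indicator_def)
      with \<open>\<omega> \<in> space M\<close> show "(\<Sum>i. ennreal (p (g n i)) * indicator {\<omega>\<in>space M. j n \<omega> = i} \<omega>) = ennreal (p (g n (j n \<omega>)))"
        by (simp add: indicator_def)
    qed
    finally show ?thesis .
  qed
  have approx: "L t \<omega> < g n (j n \<omega>)" "g n (j n \<omega>) \<le> L t \<omega> + 1 / real (Suc n)" if "0 \<le> L t \<omega>" for n \<omega>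
  proof -
    let ?y = "real (Suc n) * L t \<omega>"
    have j: "real (j n \<omega>) \<le> ?y" "?y < real (j n \<omega>) + 1"
      using that unfolding j_def by (auto intro: floor_correct)
    have "?y < real (Suc (j n \<omega>))" using j by simp
    then show "L t \<omega> < g n (j n \<omega>)" unfolding g_def by (simp add: pos_less_divide_eq mult.commute)
    have "real (Suc (j n \<omega>)) \<le> (L t \<omega> + 1 / real (Suc n)) * real (Suc n)"
    proof -
      have "(L t \<omega> + 1 / real (Suc n)) * real (Suc n) = ?y + 1"
        by (simp add: distrib_left mult.commute del: of_nat_Suc)
      moreover have "real (Suc (j n \<omega>)) = real (j n \<omega>) + 1" by simp
      ultimately show ?thesis using j(1) by linarith
    qed
    then show "g n (j n \<omega>) \<le> L t \<omega> + 1 / real (Suc n)" unfolding g_def by (simp add: pos_divide_le_eq del: of_nat_Suc)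
  qed
  have g_lim: "filterlim (\<lambda>n. g n (j n \<omega>)) (at_right (L t \<omega>)) sequentially" if "0 \<le> L t \<omega>" for \<omega>
    unfolding filterlim_at
  proof
    have "(\<lambda>n. L t \<omega> + 1 / real (Suc n)) \<longlonglongrightarrow> L t \<omega> + 0"
      by (intro tendsto_add tendsto_const LIMSEQ_Suc[OF lim_1_over_n])
    then have upper: "(\<lambda>n. L t \<omega> + 1 / real (Suc n)) \<longlonglongrightarrow> L t \<omega>" by simp
    show "(\<lambda>n. g n (j n \<omega>)) \<longlonglongrightarrow> L t \<omega>"
      by (rule tendsto_sandwich[OF always_eventually always_eventually tendsto_const upper])
         (use approx[OF that] less_imp_le in blast)+
    show "\<forall>\<^sub>F n in sequentially. g n (j n \<omega>) \<in> {L t \<omega><..} \<and> g n (j n \<omega>) \<noteq> L t \<omega>"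
      using approx(1)[OF that] by (intro always_eventually allI) (metis greaterThan_iff less_irrefl)
  qed
  have "(\<lambda>n. \<integral>\<^sup>+\<omega>. indicator {\<omega>\<in>space M. N1 (g n (j n \<omega>)) \<omega> = k} \<omega> \<partial>M)
      \<longlonglongrightarrow> (\<integral>\<^sup>+\<omega>. indicator {\<omega>\<in>space M. N \<omega> = k} \<omega> \<partial>M)"
  proof (rule nn_integral_dominated_convergence[where w = "\<lambda>_. 1"])
    have "AE \<omega> in M. cadlag (\<lambda>s. real (N1 s \<omega>))"
      using N1 by (auto simp: poisson_process_def levy_process_def)
    with L(2) N(2) show "AE \<omega> in M. (\<lambda>n. indicator {\<omega>\<in>space M. N1 (g n (j n \<omega>)) \<omega> = k} \<omega> :: ennreal)
        \<longlonglongrightarrow> indicator {\<omega>\<in>space M. N \<omega> = k} \<omega>"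
    proof eventually_elim
      case (elim \<omega>)
      have "((\<lambda>s. real (N1 s \<omega>)) \<longlongrightarrow> real (N1 (L t \<omega>) \<omega>)) (at_right (L t \<omega>))"
        using elim by (auto simp: cadlag_def)
      from filterlim_compose[OF this g_lim[OF elim(1)]]
      have "(\<lambda>n. real (N1 (g n (j n \<omega>)) \<omega>)) \<longlonglongrightarrow> real (N \<omega>)"
        using elim(2) by simp
      \<comment> \<open>Integer values at distance less than 1 coincide, so the indicators are
        eventually constant.\<close>
      then have "\<forall>\<^sub>F n in sequentially. \<bar>real (N1 (g n (j n \<omega>)) \<omega>) - real (N \<omega>)\<bar> < 1"
        unfolding tendsto_iff dist_real_def by (elim allE[of _ 1]) auto
      then have "\<forall>\<^sub>F n in sequentially. (indicator {\<omega>\<in>space M. N1 (g n (j n \<omega>)) \<omega> = k} \<omega> :: ennreal)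
          = indicator {\<omega>\<in>space M. N \<omega> = k} \<omega>"
      proof eventually_elim
        case (elim n)
        then have "N1 (g n (j n \<omega>)) \<omega> = N \<omega>" by linarith
        then show ?case by (auto simp: indicator_def)
      qed
      then show ?case by (rule tendsto_eventually)
    qed
  qed (auto simp: emeasure_space_1 split: split_indicator)
  moreover have "(\<lambda>n. \<integral>\<^sup>+\<omega>. ennreal (p (g n (j n \<omega>))) \<partial>M) \<longlonglongrightarrow> (\<integral>\<^sup>+\<omega>. ennreal (p (L t \<omega>)) \<partial>M)"
  proof (rule nn_integral_dominated_convergence[where w = "\<lambda>_. 1"])
    show "AE \<omega> in M. (\<lambda>n. ennreal (p (g n (j n \<omega>)))) \<longlonglongrightarrow> ennreal (p (L t \<omega>))"
      using L(2)
    proof eventually_elim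
      case (elim \<omega>)
      have "isCont p (L t \<omega>)" unfolding p_def[abs_def] by (intro continuous_intros) auto
      moreover have "(\<lambda>n. g n (j n \<omega>)) \<longlonglongrightarrow> L t \<omega>"
        using g_lim[OF elim] by (simp add: filterlim_at)
      ultimately show ?case by (intro tendsto_ennrealI isCont_tendsto_compose[where g = p])
    qed
    show "AE \<omega> in M. ennreal (p (g n (j n \<omega>))) \<le> 1" for n
      using p_01[OF g] by (auto simp: ennreal_le_1)
  qed (auto simp: emeasure_space_1)
  ultimately have "(\<integral>\<^sup>+\<omega>. indicator {\<omega>\<in>space M. N \<omega> = k} \<omega> \<partial>M) = (\<integral>\<^sup>+\<omega>. ennreal (p (L t \<omega>)) \<partial>M)"
    unfolding discr by (rule LIMSEQ_unique)
  also have "(\<integral>\<^sup>+\<omega>. indicator {\<omega>\<in>space M. N \<omega> = k} \<omega> \<partial>M) = emeasure M {\<omega>\<in>space M. N \<omega> = k}"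
    by (subst nn_integral_indicator) auto
  also have "(\<integral>\<^sup>+\<omega>. ennreal (p (L t \<omega>)) \<partial>M) = (\<integral>\<^sup>+\<omega>. ennreal (exp (- (lambda * L t \<omega>)) * (lambda * L t \<omega>) ^ k / fact k) \<partial>M)"
    by (simp add: p_def)
  finally show ?thesis .
qed

text \<open>Probability generating function of the Poisson law with mean \<open>r\<close>, from the
  exponential series at \<open>r * x\<close>.\<close>

lemma suminf_poisson_gen_fun:
  fixes r x :: real
  assumes "0 \<le> r" "0 \<le> x"
  shows "(\<Sum>k. ennreal (x ^ k) * ennreal (exp (- r) * r ^ k / fact k)) = ennreal (exp (r * (x - 1)))"
proof -
  have "(\<lambda>k. exp (- r) * ((r * x) ^ k /\<^sub>R fact k)) sums (exp (- r) * exp (r * x))"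
    by (intro sums_mult exp_converges)
  moreover have "exp (- r) * ((r * x) ^ k /\<^sub>R fact k) = x ^ k * (exp (- r) * r ^ k / fact k)" for k
    by (simp add: power_mult_distrib divide_inverse)
  moreover have "exp (- r) * exp (r * x) = exp (r * (x - 1))"
    by (simp add: exp_add[symmetric] algebra_simps)
  ultimately have "(\<lambda>k. x ^ k * (exp (- r) * r ^ k / fact k)) sums exp (r * (x - 1))" by simp
  moreover have "ennreal (x ^ k) * ennreal (exp (- r) * r ^ k / fact k) = ennreal (x ^ k * (exp (- r) * r ^ k / fact k))" for k
    by (rule ennreal_mult[symmetric]) (use assms in auto)
  ultimately show ?thesis using assms by (simp only:) (intro suminf_ennreal_eq, auto)
qed

lemma (in prob_space) nn_integral_exp_sum_iid:
  fixes X :: "nat \<Rightarrow> 'a \<Rightarrow> real"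
  assumes indep: "indep_vars (\<lambda>_. borel) X {1..}"
    and ident: "\<And>n. n \<ge> 1 \<Longrightarrow> distr M borel (X n) = distr M borel (X 1)"
  shows "(\<integral>\<^sup>+\<omega>. ennreal (exp (\<eta> * (\<Sum>k = 1..n. X k \<omega>))) \<partial>M) = (\<integral>\<^sup>+\<omega>. ennreal (exp (\<eta> * X 1 \<omega>)) \<partial>M) ^ n"
proof -
  have X [measurable]: "X k \<in> borel_measurable M" if "1 \<le> k" for k
    using indep that by (auto simp: indep_vars_def)
  have "indep_vars (\<lambda>_. borel) X {1..n}" using indep by (rule indep_vars_subset) auto
  then have ind: "indep_vars (\<lambda>_. borel) (\<lambda>k \<omega>. ennreal (exp (\<eta> * X k \<omega>))) {1..n}"
    by (rule indep_vars_compose2[where Y = "\<lambda>_ x. ennreal (exp (\<eta> * x))"]) auto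
  have "(\<integral>\<^sup>+\<omega>. ennreal (exp (\<eta> * (\<Sum>k = 1..n. X k \<omega>))) \<partial>M) = (\<integral>\<^sup>+\<omega>. (\<Prod>k = 1..n. ennreal (exp (\<eta> * X k \<omega>))) \<partial>M)"
    by (simp add: sum_distrib_left exp_sum prod_ennreal)
  also have "\<dots> = (\<Prod>k = 1..n. \<integral>\<^sup>+\<omega>. ennreal (exp (\<eta> * X k \<omega>)) \<partial>M)"
    by (rule indep_vars_nn_integral[OF _ ind]) auto
  also have "\<dots> = (\<Prod>k = 1..n. \<integral>\<^sup>+\<omega>. ennreal (exp (\<eta> * X 1 \<omega>)) \<partial>M)"
  proof (intro prod.cong refl)
    fix k assume k: "k \<in> {1..n}"
    have "(\<integral>\<^sup>+\<omega>. ennreal (exp (\<eta> * X k \<omega>)) \<partial>M) = (\<integral>\<^sup>+x. ennreal (exp (\<eta> * x)) \<partial>distr M borel (X k))"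
      using k X[of k] by (subst nn_integral_distr) auto
    also have "\<dots> = (\<integral>\<^sup>+\<omega>. ennreal (exp (\<eta> * X 1 \<omega>)) \<partial>M)"
      using k X[of 1] by (subst ident, simp, subst nn_integral_distr) auto
    finally show "(\<integral>\<^sup>+\<omega>. ennreal (exp (\<eta> * X k \<omega>)) \<partial>M) = (\<integral>\<^sup>+\<omega>. ennreal (exp (\<eta> * X 1 \<omega>)) \<partial>M)" .
  qed
  also have "\<dots> = (\<integral>\<^sup>+\<omega>. ennreal (exp (\<eta> * X 1 \<omega>)) \<partial>M) ^ n" by simp
  finally show ?thesis .
qed

lemma (in prob_space) random_sum_measurable:
  assumes "\<And>k. 1 \<le> k \<Longrightarrow> X k \<in> borel_measurable M" and "N t \<in> measurable M (count_space UNIV)"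
  shows "random_sum X N t \<in> borel_measurable M"
  unfolding random_sum_def[abs_def]
  by (rule measurable_compose_countable[OF _ assms(2), where f = "\<lambda>n \<omega>. \<Sum>k = 1..n. X k \<omega>"])
     (use assms(1) in \<open>auto intro: borel_measurable_sum\<close>)

lemma (in prob_space) nn_integral_exp_random_sum:
  fixes X :: "nat \<Rightarrow> 'a \<Rightarrow> real" and N :: "real \<Rightarrow> 'a \<Rightarrow> nat"
  assumes X: "indep_vars (\<lambda>_. borel) X {1..}"
    and ident: "\<And>n. n \<ge> 1 \<Longrightarrow> distr M borel (X n) = distr M borel (X 1)"
    and indep: "indep_families borel {1..} X (count_space UNIV) {0..} N" and "0 \<le> t"
  shows "(\<integral>\<^sup>+\<omega>. ennreal (exp (\<eta> * random_sum X N t \<omega>)) \<partial>M) =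
    (\<Sum>n. (\<integral>\<^sup>+\<omega>. ennreal (exp (\<eta> * X 1 \<omega>)) \<partial>M) ^ n * emeasure M {\<omega>\<in>space M. N t \<omega> = n})"
proof -
  let ?G = "\<Union>i\<in>{1..}. {X i -` A \<inter> space M | A. A \<in> sets borel}"
  let ?H = "\<Union>j\<in>{0..}. {N j -` B \<inter> space M | B. B \<in> sets (count_space UNIV)}"
  have X_meas [measurable]: "X k \<in> borel_measurable M" if "1 \<le> k" for k
    using X that by (auto simp: indep_vars_def)
  have N [measurable]: "N t \<in> measurable M (count_space UNIV)"
    using indep \<open>0 \<le> t\<close> by (auto simp: indep_families_def)
  have indep_set: "indep_set (sigma_sets (space M) ?G) (sigma_sets (space M) ?H)"
    by (rule indep_familiesD[OF indep])
  define E where "E n \<omega> = ennreal (exp (\<eta> * (\<Sum>k = 1..n. X k \<omega>)))" for n \<omega>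
  have E_meas [measurable]: "E n \<in> borel_measurable M" for n
    unfolding E_def[abs_def] by (auto intro!: measurable_compose[OF _ measurable_ennreal] borel_measurable_exp borel_measurable_times borel_measurable_sum)
  have prod: "(\<integral>\<^sup>+\<omega>. E n \<omega> * indicator {\<omega>\<in>space M. N t \<omega> = n} \<omega> \<partial>M)
      = (\<integral>\<^sup>+\<omega>. E n \<omega> \<partial>M) * emeasure M {\<omega>\<in>space M. N t \<omega> = n}" for n
  proof -
    \<comment> \<open>\<open>E n\<close> involves several \<open>X k\<close> at once. It is
      independent of \<open>N t\<close> because it is measurable for the sigma-algebra generated by
      the whole family \<open>X\<close>, which is the object in
      \<open>indep_families\<close>.\<close>
    let ?\<Sigma> = "sigma (space M) ?G"
    have G: "?G \<subseteq> Pow (space M)" by auto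
    have "X k \<in> borel_measurable ?\<Sigma>" if "1 \<le> k" for k
      using that G by (intro measurableI) (auto simp: sets_measure_of space_measure_of_conv intro!: sigma_sets.Basic)
    then have "E n \<in> borel_measurable ?\<Sigma>"
      unfolding E_def[abs_def] by (auto intro!: measurable_compose[OF _ measurable_ennreal] borel_measurable_exp borel_measurable_times borel_measurable_sum)
    then have E_sets: "E n -` A \<inter> space M \<in> sigma_sets (space M) ?G" if "A \<in> sets borel" for A
      using measurable_sets[OF _ that, of "E n" ?\<Sigma>] G by (simp add: sets_measure_of space_measure_of_conv)
    define J where "J \<omega> = (indicator {n} (N t \<omega>) :: ennreal)" for \<omega>
    have J_meas [measurable]: "J \<in> borel_measurable M" unfolding J_def[abs_def] by (rule measurable_compose[OF N]) simp
    have J_sets: "J -` B \<inter> space M \<in> sigma_sets (space M) ?H" for B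
    proof -
      have "J -` B \<inter> space M = N t -` ((\<lambda>m. indicator {n} m :: ennreal) -` B) \<inter> space M"
        by (auto simp: J_def)
      with \<open>0 \<le> t\<close> show ?thesis by (auto intro!: sigma_sets.Basic)
    qed
    have "indep_var borel (E n) borel J"
      unfolding indep_var_eq
    proof (intro conjI)
      have "sigma_sets (space M) {E n -` A \<inter> space M | A. A \<in> sets borel} \<subseteq> sigma_sets (space M) ?G"
        using E_sets by (intro sigma_sets_mono) auto
      moreover have "sigma_sets (space M) {J -` A \<inter> space M | A. A \<in> sets borel} \<subseteq> sigma_sets (space M) ?H"
        using J_sets by (intro sigma_sets_mono) auto
      ultimately show "indep_set (sigma_sets (space M) {E n -` A \<inter> space M | A. A \<in> sets borel})
          (sigma_sets (space M) {J -` A \<inter> space M | A. A \<in> sets borel})"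
        using indep_set unfolding indep_set_def
        by (elim indep_sets_mono_sets) (auto split: bool.split)
    qed measurable
    then have "indep_vars (\<lambda>_. borel) (case_bool (E n) J) UNIV"
      by (simp add: indep_var_def case_bool_if[abs_def] if_distrib cong: if_cong)
    from indep_vars_nn_integral[OF _ this]
    have "(\<integral>\<^sup>+\<omega>. E n \<omega> * J \<omega> \<partial>M) = (\<integral>\<^sup>+\<omega>. E n \<omega> \<partial>M) * (\<integral>\<^sup>+\<omega>. J \<omega> \<partial>M)"
      by (simp add: UNIV_bool mult.commute)
    moreover have "(\<integral>\<^sup>+\<omega>. E n \<omega> * J \<omega> \<partial>M) = (\<integral>\<^sup>+\<omega>. E n \<omega> * indicator {\<omega>\<in>space M. N t \<omega> = n} \<omega> \<partial>M)"
      by (intro nn_integral_cong) (auto simp: J_def indicator_def)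
    moreover have "(\<integral>\<^sup>+\<omega>. J \<omega> \<partial>M) = (\<integral>\<^sup>+\<omega>. indicator {\<omega>\<in>space M. N t \<omega> = n} \<omega> \<partial>M)"
      by (intro nn_integral_cong) (auto simp: J_def indicator_def)
    moreover have "(\<integral>\<^sup>+\<omega>. indicator {\<omega>\<in>space M. N t \<omega> = n} \<omega> \<partial>M) = emeasure M {\<omega>\<in>space M. N t \<omega> = n}"
      by (rule nn_integral_indicator) measurable
    ultimately show ?thesis by simp
  qed
  have "(\<integral>\<^sup>+\<omega>. ennreal (exp (\<eta> * random_sum X N t \<omega>)) \<partial>M)
      = (\<integral>\<^sup>+\<omega>. (\<Sum>n. E n \<omega> * indicator {\<omega>\<in>space M. N t \<omega> = n} \<omega>) \<partial>M)"
  proof (intro nn_integral_cong)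
    fix \<omega> assume "\<omega> \<in> space M"
    have "(\<Sum>n. E n \<omega> * indicator {\<omega>\<in>space M. N t \<omega> = n} \<omega>)
        = (\<Sum>n\<in>{N t \<omega>}. E n \<omega> * indicator {\<omega>\<in>space M. N t \<omega> = n} \<omega>)"
      by (intro suminf_finite) (auto simp: indicator_def)
    with \<open>\<omega> \<in> space M\<close> show "ennreal (exp (\<eta> * random_sum X N t \<omega>)) = (\<Sum>n. E n \<omega> * indicator {\<omega>\<in>space M. N t \<omega> = n} \<omega>)"
      by (simp add: E_def random_sum_def indicator_def)
  qed
  also have "\<dots> = (\<Sum>n. \<integral>\<^sup>+\<omega>. E n \<omega> * indicator {\<omega>\<in>space M. N t \<omega> = n} \<omega> \<partial>M)"
    by (intro nn_integral_suminf) measurable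
  also have "\<dots> = (\<Sum>n. (\<integral>\<^sup>+\<omega>. ennreal (exp (\<eta> * X 1 \<omega>)) \<partial>M) ^ n * emeasure M {\<omega>\<in>space M. N t \<omega> = n})"
  proof -
    have "(\<integral>\<^sup>+\<omega>. E n \<omega> \<partial>M) = (\<integral>\<^sup>+\<omega>. ennreal (exp (\<eta> * X 1 \<omega>)) \<partial>M) ^ n" for n
      unfolding E_def by (rule nn_integral_exp_sum_iid[OF X ident])
    then show ?thesis by (simp only: prod)
  qed
  finally show ?thesis .
qed

lemma (in prob_space) nn_integral_exp_random_sum_fractional:
  fixes X :: "nat \<Rightarrow> 'a \<Rightarrow> real" and N :: "real \<Rightarrow> 'a \<Rightarrow> nat"
  assumes X: "indep_vars (\<lambda>_. borel) X {1..}"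
    and ident: "\<And>n. n \<ge> 1 \<Longrightarrow> distr M borel (X n) = distr M borel (X 1)"
    and indep: "indep_families borel {1..} X (count_space UNIV) {0..} N" and "0 \<le> t"
    and N1: "poisson_process lambda N1" and "0 < lambda"
    and L: "inverse_stable_subordinator \<nu> L"
    and indep_L: "indep_families (count_space UNIV) {0..} N1 borel {0..} L"
    and N: "AE \<omega> in M. \<forall>t\<ge>0. N t \<omega> = N1 (L t \<omega>) \<omega>"
    and integrable: "integrable M (\<lambda>\<omega>. exp (\<eta> * X 1 \<omega>))"
  shows "(\<integral>\<^sup>+\<omega>. ennreal (exp (\<eta> * random_sum X N t \<omega>)) \<partial>M) =
    (\<integral>\<^sup>+\<omega>. ennreal (exp (lambda * (expectation (\<lambda>\<omega>. exp (\<eta> * X 1 \<omega>)) - 1) * L t \<omega>)) \<partial>M)"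
proof -
  define \<phi> where "\<phi> = expectation (\<lambda>\<omega>. exp (\<eta> * X 1 \<omega>))"
  have "0 \<le> \<phi>" by (simp add: \<phi>_def)
  have \<phi>: "(\<integral>\<^sup>+\<omega>. ennreal (exp (\<eta> * X 1 \<omega>)) \<partial>M) = ennreal \<phi>"
    unfolding \<phi>_def by (rule nn_integral_eq_integral[OF integrable]) simp
  note [measurable] = inverse_stable_subordinator_measurable[OF L \<open>0 \<le> t\<close>]
  have nonneg: "AE \<omega> in M. 0 \<le> L t \<omega>"
    by (rule AE_inverse_stable_subordinator_nonneg[OF L \<open>0 \<le> t\<close>])
  have N_meas: "N t \<in> measurable M (count_space UNIV)"
    using indep \<open>0 \<le> t\<close> by (auto simp: indep_families_def)
  have N_AE: "AE \<omega> in M. N t \<omega> = N1 (L t \<omega>) \<omega>"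
    using N \<open>0 \<le> t\<close> by (auto elim: eventually_mono)
  \<comment> \<open>Truncating \<open>L t\<close> at 0 changes it only on a null set and makes the
    generating function identity valid at every point.\<close>
  let ?q = "\<lambda>k \<omega>. exp (- (lambda * max 0 (L t \<omega>))) * (lambda * max 0 (L t \<omega>)) ^ k / fact k"
  have law: "emeasure M {\<omega>\<in>space M. N t \<omega> = k} = (\<integral>\<^sup>+\<omega>. ennreal (?q k \<omega>) \<partial>M)" for k
  proof -
    have "emeasure M {\<omega>\<in>space M. N t \<omega> = k} = (\<integral>\<^sup>+\<omega>. ennreal (exp (- (lambda * L t \<omega>)) * (lambda * L t \<omega>) ^ k / fact k) \<partial>M)"
      by (rule emeasure_poisson_process_random_time[OF N1 \<open>0 < lambda\<close> _ nonneg indep_L \<open>0 \<le> t\<close> N_meas N_AE]) measurable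
    also have "\<dots> = (\<integral>\<^sup>+\<omega>. ennreal (?q k \<omega>) \<partial>M)"
      using nonneg by (intro nn_integral_cong_AE) (auto elim!: eventually_mono)
    finally show ?thesis .
  qed
  have "(\<integral>\<^sup>+\<omega>. ennreal (exp (\<eta> * random_sum X N t \<omega>)) \<partial>M) = (\<Sum>n. ennreal \<phi> ^ n * (\<integral>\<^sup>+\<omega>. ennreal (?q n \<omega>) \<partial>M))"
    using nn_integral_exp_random_sum[OF X ident indep \<open>0 \<le> t\<close>, of \<eta>] by (simp only: \<phi> law)
  also have "\<dots> = (\<Sum>n. ennreal (\<phi> ^ n) * (\<integral>\<^sup>+\<omega>. ennreal (?q n \<omega>) \<partial>M))"
    using \<open>0 \<le> \<phi>\<close> by (simp add: ennreal_power)
  also have "\<dots> = (\<integral>\<^sup>+\<omega>. (\<Sum>n. ennreal (\<phi> ^ n) * ennreal (?q n \<omega>)) \<partial>M)"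
    by (subst nn_integral_suminf) (auto simp: nn_integral_cmult)
  also have "\<dots> = (\<integral>\<^sup>+\<omega>. ennreal (exp (lambda * max 0 (L t \<omega>) * (\<phi> - 1))) \<partial>M)"
    using \<open>0 < lambda\<close> \<open>0 \<le> \<phi>\<close> by (intro nn_integral_cong suminf_poisson_gen_fun) auto
  also have "\<dots> = (\<integral>\<^sup>+\<omega>. ennreal (exp (lambda * (\<phi> - 1) * L t \<omega>)) \<partial>M)"
    using nonneg
  proof (intro nn_integral_cong_AE, eventually_elim)
    case (elim \<omega>)
    then show ?case by (simp add: mult_ac)
  qed
  finally show ?thesis by (simp add: \<phi>_def)
qed

section \<open>The rate function and its Legendre duality\<close>

text \<open>Common form of all cases of \<open>I_MD\<close>: on \<open>S\<close> it is the Legendre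
  transform of the function \<open>(k * \<bar>\<theta>\<bar>) powr (1 / q)\<close>. For mean 0,
  \<open>q = \<nu> / 2\<close> and \<open>S\<close> is the line; otherwise \<open>q = \<nu>\<close>
  and \<open>S\<close> is a half-line.\<close>

definition power_rate :: "real \<Rightarrow> real \<Rightarrow> real set \<Rightarrow> real \<Rightarrow> ereal" where
  "power_rate q k S x = (if x \<in> S
     then ereal ((q powr (q / (1 - q)) - q powr (1 / (1 - q))) * (\<bar>x\<bar> / k) powr (1 / (1 - q)))
     else \<infinity>)"

lemma power_rate_const_pos:
  fixes q :: real
  assumes "0 < q" "q < 1"
  shows "0 < q powr (q / (1 - q)) - q powr (1 / (1 - q))"
proof -
  have "q / (1 - q) < 1 / (1 - q)" using assms by (intro divide_strict_right_mono) auto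
  then show ?thesis using assms powr_less_mono'[of q "q / (1 - q)" "1 / (1 - q)"] by simp
qed

lemma good_rate_function_power_rate:
  assumes q: "0 < q" "q < 1" and "0 < k" and "closed S"
  shows "good_rate_function (power_rate q k S)"
proof (rule good_rate_functionI)
  let ?C = "q powr (q / (1 - q)) - q powr (1 / (1 - q))"
  have C: "0 < ?C" by (rule power_rate_const_pos[OF q])
  show "0 \<le> power_rate q k S x" for x using C by (simp add: power_rate_def)
  fix \<beta> :: real assume "0 \<le> \<beta>"
  \<comment> \<open>\<open>R\<close> is where the power reaches the level \<open>\<beta>\<close>, so
    the level set is \<open>S\<close> cut by a compact interval.\<close>
  define R where "R = k * (\<beta> / ?C) powr (1 - q)"
  have iff: "?C * (\<bar>x\<bar> / k) powr (1 / (1 - q)) \<le> \<beta> \<longleftrightarrow> \<bar>x\<bar> \<le> R" for x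
  proof -
    have "?C * (\<bar>x\<bar> / k) powr (1 / (1 - q)) \<le> \<beta> \<longleftrightarrow> (\<bar>x\<bar> / k) powr (1 / (1 - q)) \<le> \<beta> / ?C"
      using C by (simp add: field_simps)
    also have "\<dots> \<longleftrightarrow> \<bar>x\<bar> / k \<le> (\<beta> / ?C) powr (1 - q)"
    proof
      assume "(\<bar>x\<bar> / k) powr (1 / (1 - q)) \<le> \<beta> / ?C"
      then have "((\<bar>x\<bar> / k) powr (1 / (1 - q))) powr (1 - q) \<le> (\<beta> / ?C) powr (1 - q)"
        using q by (intro powr_mono2) auto
      then show "\<bar>x\<bar> / k \<le> (\<beta> / ?C) powr (1 - q)" using q \<open>0 < k\<close> by (simp add: powr_powr)
    next
      assume "\<bar>x\<bar> / k \<le> (\<beta> / ?C) powr (1 - q)"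
      then have "(\<bar>x\<bar> / k) powr (1 / (1 - q)) \<le> ((\<beta> / ?C) powr (1 - q)) powr (1 / (1 - q))"
        using q \<open>0 < k\<close> by (intro powr_mono2) auto
      then show "(\<bar>x\<bar> / k) powr (1 / (1 - q)) \<le> \<beta> / ?C"
        using q C \<open>0 \<le> \<beta>\<close> by (simp add: powr_powr)
    qed
    also have "\<dots> \<longleftrightarrow> \<bar>x\<bar> \<le> R"
      using \<open>0 < k\<close> by (simp add: R_def field_simps)
    finally show ?thesis .
  qed
  have "{x. power_rate q k S x \<le> ereal \<beta>} = S \<inter> {- R..R}"
  proof (intro set_eqI)
    fix x
    show "x \<in> {x. power_rate q k S x \<le> ereal \<beta>} \<longleftrightarrow> x \<in> S \<inter> {- R..R}"
      using iff[of x] by (cases "x \<in> S") (simp_all add: power_rate_def abs_le_iff minus_le_iff conj_commute)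
  qed
  with closed_Int_compact[OF \<open>closed S\<close> compact_Icc]
  show "compact {x. power_rate q k S x \<le> ereal \<beta>}" by (simp only:)
qed

text \<open>The witness solves the stationarity equation
  \<open>x = k / q * (k * \<theta>) powr (1 / q - 1)\<close>. With
  \<open>y = (x / k) powr (1 / (1 - q))\<close> and \<open>A = q powr (q / (1 - q))\<close> it
  satisfies \<open>\<theta> * x = A * y\<close> and
  \<open>(k * \<theta>) powr (1 / q) = q * A * y\<close>, which is the origin of the two terms of
  the constant.\<close>

lemma legendre_powr:
  fixes q k x :: real
  assumes q: "0 < q" "q < 1" and "0 < k" "0 < x"
  obtains \<theta> where "0 < \<theta>"
    and "((\<lambda>\<eta>. (k * \<eta>) powr (1 / q)) has_real_derivative x) (at \<theta>)"
    and "\<theta> * x - (k * \<theta>) powr (1 / q)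
      = (q powr (q / (1 - q)) - q powr (1 / (1 - q))) * (x / k) powr (1 / (1 - q))"
proof -
  define y where "y = (x / k) powr (1 / (1 - q))"
  define A where "A = q powr (q / (1 - q))"
  define \<theta> where "\<theta> = A * y / x"
  have pos: "0 < y" "0 < A" "0 < \<theta>" using assms by (auto simp: y_def A_def \<theta>_def)
  have "y powr (1 - q) = x / k" using assms by (simp add: y_def powr_powr)
  moreover have "k * \<theta> = A * (y / (x / k))"
    using assms by (simp add: \<theta>_def)
  ultimately have "k * \<theta> = A * (y / y powr (1 - q))" by simp
  also have "y / y powr (1 - q) = y powr q" using pos by (simp add: powr_diff)
  finally have k\<theta>: "(k * \<theta>) powr (1 / q) = q powr (1 / (1 - q)) * y"
    using q pos by (simp add: powr_mult powr_powr A_def)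
  have "q powr (1 / (1 - q)) = q powr (q / (1 - q) + 1)"
    using q by (intro arg_cong[where f = "\<lambda>z. q powr z"]) (simp add: field_simps)
  then have qA: "q powr (1 / (1 - q)) = q * A" using q by (simp add: A_def powr_add)
  have "((\<lambda>\<eta>. (k * \<eta>) powr (1 / q)) has_real_derivative (1 / q) * (k * \<theta>) powr (1 / q - 1) * k) (at \<theta>)"
    using pos \<open>0 < k\<close> by (auto intro!: derivative_eq_intros)
  also have "(1 / q) * (k * \<theta>) powr (1 / q - 1) * k = (1 / q) * (k * \<theta>) powr (1 / q) / \<theta>"
    using pos \<open>0 < k\<close> by (simp add: powr_diff)
  also have "\<dots> = x"
    using pos q assms unfolding k\<theta> qA by (simp add: \<theta>_def)
  finally have deriv: "((\<lambda>\<eta>. (k * \<eta>) powr (1 / q)) has_real_derivative x) (at \<theta>)" .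
  have "\<theta> * x = A * y" using assms by (simp add: \<theta>_def)
  then show thesis
    by (intro that[OF pos(3) deriv]) (simp only: k\<theta> y_def[symmetric] A_def[symmetric] left_diff_distrib)
qed

text \<open>The bound is of smaller order than \<open>h\<close> because \<open>1 / q > 1\<close>. It
  serves at 0, where the cumulant limit may be a power on one side and 0 on the other.\<close>

lemma has_real_derivative_0_of_powr_bound:
  fixes \<Lambda> :: "real \<Rightarrow> real"
  assumes "0 < q" "q < 1" "0 < k" and bound: "\<And>h. \<bar>\<Lambda> h\<bar> \<le> (k * \<bar>h\<bar>) powr (1 / q)"
  shows "(\<Lambda> has_real_derivative 0) (at 0)"
proof -
  have "\<Lambda> 0 = 0" using bound[of 0] by simp
  have "1 / q - 1 > 0" using assms by simp
  have "((\<lambda>h. (\<Lambda> (0 + h) - \<Lambda> 0) / h) \<longlongrightarrow> 0) (at 0)"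
  proof (rule Lim_null_comparison)
    have "norm ((\<Lambda> (0 + h) - \<Lambda> 0) / h) \<le> k powr (1 / q) * \<bar>h\<bar> powr (1 / q - 1)" if "h \<noteq> 0" for h
    proof -
      have "norm ((\<Lambda> (0 + h) - \<Lambda> 0) / h) \<le> (k * \<bar>h\<bar>) powr (1 / q) / \<bar>h\<bar>"
        using bound[of h] \<open>\<Lambda> 0 = 0\<close> by (simp add: divide_right_mono)
      also have "\<dots> = k powr (1 / q) * \<bar>h\<bar> powr (1 / q - 1)"
        using \<open>0 < k\<close> that by (simp add: powr_mult powr_diff)
      finally show ?thesis .
    qed
    with eventually_neq_at_within[of 0 0]
    show "\<forall>\<^sub>F h in at 0. norm ((\<Lambda> (0 + h) - \<Lambda> 0) / h) \<le> k powr (1 / q) * \<bar>h\<bar> powr (1 / q - 1)"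
      by (rule eventually_mono)
    have "((\<lambda>h::real. \<bar>h\<bar> powr (1 / q - 1)) \<longlongrightarrow> 0) (at 0)"
      using \<open>1 / q - 1 > 0\<close>
      by (intro tendsto_zero_powrI[OF _ tendsto_const]) (auto intro!: tendsto_rabs_zero)
    from tendsto_mult_left[OF this, of "k powr (1 / q)"]
    show "((\<lambda>h. k powr (1 / q) * \<bar>h\<bar> powr (1 / q - 1)) \<longlongrightarrow> 0) (at 0)" by simp
  qed
  then show ?thesis by (simp add: DERIV_def)
qed

text \<open>Supplies the two duality hypotheses of \<open>gartner_ellis\<close>. Membership in
  \<open>S\<close> depends only on the sign, so the reflection by \<open>s = 1\<close> or
  \<open>s = - 1\<close> reduces both half-lines to the positive one.\<close>

lemma power_rate_legendre:
  fixes \<Lambda> :: "real \<Rightarrow> real"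
  assumes q: "0 < q" "q < 1" and "0 < k"
    and cone: "\<And>x. x \<in> S \<longleftrightarrow> x = 0 \<or> sgn x \<in> S"
    and \<Lambda>0: "\<Lambda> 0 = 0"
    and \<Lambda>_in: "\<And>s \<eta>. s = 1 \<or> s = - 1 \<Longrightarrow> s \<in> S \<Longrightarrow> 0 < \<eta> \<Longrightarrow> \<Lambda> (s * \<eta>) = (k * \<eta>) powr (1 / q)"
    and \<Lambda>_out: "\<And>s \<eta>. s = 1 \<or> s = - 1 \<Longrightarrow> s \<notin> S \<Longrightarrow> 0 < \<eta> \<Longrightarrow> \<Lambda> (s * \<eta>) = 0"
  shows "power_rate q k S x \<noteq> \<infinity> \<Longrightarrow>
      \<exists>\<theta>. (\<Lambda> has_real_derivative x) (at \<theta>) \<and> power_rate q k S x = ereal (\<theta> * x - \<Lambda> \<theta>) \<and> 0 \<le> \<theta> * x"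
    and "power_rate q k S x = \<infinity> \<Longrightarrow> \<exists>\<theta>. 0 \<le> \<theta> * x \<and> c \<le> \<theta> * x - \<Lambda> \<theta>"
proof -
  have sgn: "sgn z = 1 \<or> sgn z = - 1" "z = sgn z * \<bar>z\<bar>" "sgn z * sgn z = 1" if "z \<noteq> 0" for z :: real
    using that by (auto simp: sgn_if)
  assume "power_rate q k S x \<noteq> \<infinity>"
  then have "x \<in> S" by (auto simp: power_rate_def split: if_splits)
  show "\<exists>\<theta>. (\<Lambda> has_real_derivative x) (at \<theta>) \<and> power_rate q k S x = ereal (\<theta> * x - \<Lambda> \<theta>) \<and> 0 \<le> \<theta> * x"
  proof (cases "x = 0")
    case True
    have "\<bar>\<Lambda> h\<bar> \<le> (k * \<bar>h\<bar>) powr (1 / q)" for h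
    proof (cases "h = 0")
      case False
      then show ?thesis
        using \<Lambda>_in[of "sgn h" "\<bar>h\<bar>"] \<Lambda>_out[of "sgn h" "\<bar>h\<bar>"] sgn[OF False]
        by (cases "sgn h \<in> S") auto
    qed (simp add: \<Lambda>0)
    from has_real_derivative_0_of_powr_bound[OF q \<open>0 < k\<close> this] True \<open>x \<in> S\<close> show ?thesis
      by (intro exI[of _ 0]) (simp add: power_rate_def \<Lambda>0)
  next
    case False
    define s where "s = sgn x"
    have s: "s = 1 \<or> s = - 1" "x = s * \<bar>x\<bar>" "s * s = 1" using sgn[OF False] by (auto simp: s_def)
    have "s \<in> S" using cone[of x] \<open>x \<in> S\<close> False by (simp add: s_def)
    from False have "0 < \<bar>x\<bar>" by simp
    from legendre_powr[OF q \<open>0 < k\<close> this] obtain \<theta> where \<theta>: "0 < \<theta>"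
      "((\<lambda>\<eta>. (k * \<eta>) powr (1 / q)) has_real_derivative \<bar>x\<bar>) (at \<theta>)"
      "\<theta> * \<bar>x\<bar> - (k * \<theta>) powr (1 / q)
      = (q powr (q / (1 - q)) - q powr (1 / (1 - q))) * (\<bar>x\<bar> / k) powr (1 / (1 - q))" .
    have ss: "s * (s * \<eta>) = \<eta>" for \<eta> using s(3) by (simp add: mult.assoc[symmetric])
    have "((\<lambda>\<eta>. s * \<eta>) has_real_derivative s) (at (s * \<theta>))"
      by (auto intro!: derivative_eq_intros)
    moreover have "((\<lambda>\<eta>. (k * \<eta>) powr (1 / q)) has_real_derivative \<bar>x\<bar>) (at (s * (s * \<theta>)))"
      unfolding ss by (rule \<theta>(2))
    ultimately have "((\<lambda>\<eta>. (k * (s * \<eta>)) powr (1 / q)) has_real_derivative \<bar>x\<bar> * s) (at (s * \<theta>))"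
      by (rule DERIV_chain2[rotated])
    then have "((\<lambda>\<eta>. (k * (s * \<eta>)) powr (1 / q)) has_real_derivative x) (at (s * \<theta>))"
      by (subst s(2)) (simp only: mult.commute)
    \<comment> \<open>\<open>\<Lambda>\<close> is the power function only on the open ray through
      \<open>s * \<theta>\<close>, so the derivative is transferred locally.\<close>
    moreover have "\<forall>\<^sub>F \<eta> in nhds (s * \<theta>). (k * (s * \<eta>)) powr (1 / q) = \<Lambda> \<eta>"
    proof -
      have "open {\<eta>. 0 < s * \<eta>}" by (intro open_Collect_less continuous_intros)
      then have "\<forall>\<^sub>F \<eta> in nhds (s * \<theta>). \<eta> \<in> {\<eta>. 0 < s * \<eta>}"
        using \<theta>(1) by (intro eventually_nhds_in_open) (auto simp: ss)
      then show ?thesis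
      proof eventually_elim
        case (elim \<eta>)
        then show ?case using \<Lambda>_in[OF s(1) \<open>s \<in> S\<close>, of "s * \<eta>"] by (simp add: ss)
      qed
    qed
    ultimately have "(\<Lambda> has_real_derivative x) (at (s * \<theta>))"
      by (subst DERIV_cong_ev[OF refl _ refl, symmetric]) auto
    moreover have "s * \<theta> * x = \<theta> * \<bar>x\<bar>" by (simp add: s_def abs_sgn mult_ac)
    moreover have "power_rate q k S x = ereal (\<theta> * \<bar>x\<bar> - \<Lambda> (s * \<theta>))"
      using \<theta>(3) \<open>x \<in> S\<close> \<Lambda>_in[OF s(1) \<open>s \<in> S\<close> \<theta>(1)] by (simp add: power_rate_def)
    moreover have "0 \<le> \<theta> * \<bar>x\<bar>" using \<theta>(1) by simp
    ultimately show ?thesis by (intro exI[of _ "s * \<theta>"]) (simp only: simp_thms)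
  qed
next
  assume "power_rate q k S x = \<infinity>"
  then have "x \<notin> S" by (auto simp: power_rate_def split: if_splits)
  then have "x \<noteq> 0" "sgn x \<notin> S" using cone[of x] by auto
  \<comment> \<open>\<open>\<Lambda>\<close> vanishes on the side of \<open>x\<close>, hence
    \<open>\<theta> * x\<close> can be made as large as \<open>c\<close> without a penalty; the
    maximum with 1 keeps \<open>\<eta>\<close> positive.\<close>
  define \<eta> where "\<eta> = max 1 (c / \<bar>x\<bar>)"
  have "0 < \<eta>" "c \<le> \<eta> * \<bar>x\<bar>"
    using \<open>x \<noteq> 0\<close> by (auto simp: \<eta>_def max_mult_distrib_right pos_divide_le_eq[symmetric])
  moreover have "\<Lambda> (sgn x * \<eta>) = 0"
    using \<open>x \<noteq> 0\<close> \<open>sgn x \<notin> S\<close> \<open>0 < \<eta>\<close> by (intro \<Lambda>_out) (auto simp: sgn_if)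
  moreover have "sgn x * \<eta> * x = \<eta> * \<bar>x\<bar>" by (simp add: abs_sgn mult_ac)
  moreover have "0 \<le> \<eta> * \<bar>x\<bar>" using \<open>0 < \<eta>\<close> by simp
  ultimately show "\<exists>\<theta>. 0 \<le> \<theta> * x \<and> c \<le> \<theta> * x - \<Lambda> \<theta>"
    by (intro exI[of _ "sgn x * \<eta>"]) (simp only: diff_zero simp_thms)
qed

text \<open>For \<open>\<mu> = 0\<close>, \<open>2 * x^2 / (lambda * v)\<close> is the square of
  \<open>\<bar>x\<bar> / k\<close>, which doubles the exponent \<open>1 / (2 - \<nu>)\<close> to
  \<open>1 / (1 - q)\<close> with \<open>q = \<nu> / 2\<close>. For \<open>\<mu> < 0\<close>, the
  signs in \<open>x / (lambda * \<mu>)\<close> cancel on the half-line of finite rate.\<close>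

lemma I_MD_eq_power_rate:
  assumes nu: "0 < \<nu>" "\<nu> < 1" and "0 < lambda" and v: "\<mu> = 0 \<Longrightarrow> 0 < v"
  shows "I_MD \<nu> lambda \<mu> v = (if \<mu> = 0 then power_rate (\<nu> / 2) (sqrt (lambda * v / 2)) UNIV
    else power_rate \<nu> (lambda * \<bar>\<mu>\<bar>) {x. 0 \<le> \<mu> * x})"
proof (cases "\<mu> = 0")
  case True
  let ?K = "lambda * v / 2"
  have "0 < ?K" using \<open>0 < lambda\<close> v[OF True] by simp
  have e: "(\<nu> / 2) / (1 - \<nu> / 2) = \<nu> / (2 - \<nu>)" "1 / (1 - \<nu> / 2) = 2 / (2 - \<nu>)"
    using nu by (auto simp: field_simps)
  have "(2 * x\<^sup>2 / (lambda * v)) powr (1 / (2 - \<nu>)) = (\<bar>x\<bar> / sqrt ?K) powr (2 / (2 - \<nu>))" for x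
  proof -
    have "2 * x\<^sup>2 / (lambda * v) = (\<bar>x\<bar> / sqrt ?K)\<^sup>2"
      using \<open>0 < ?K\<close> by (simp add: power_divide)
    also have "\<dots> powr (1 / (2 - \<nu>)) = ((\<bar>x\<bar> / sqrt ?K) powr 2) powr (1 / (2 - \<nu>))"
      using \<open>0 < ?K\<close> by (simp add: powr_numeral)
    finally show ?thesis by (simp add: powr_powr)
  qed
  then show ?thesis using True by (auto simp: fun_eq_iff I_MD_def power_rate_def e)
next
  case False
  have "I_MD \<nu> lambda \<mu> v x = power_rate \<nu> (lambda * \<bar>\<mu>\<bar>) {x. 0 \<le> \<mu> * x} x" for x
  proof (cases "0 < \<mu>")
    case True
    then have "0 \<le> \<mu> * x \<longleftrightarrow> 0 \<le> x" by (simp add: zero_le_mult_iff)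
    with True show ?thesis by (simp add: I_MD_def power_rate_def)
  next
    case neg: False
    with False have "\<mu> < 0" by simp
    then have "0 \<le> \<mu> * x \<longleftrightarrow> x \<le> 0" by (simp add: zero_le_mult_iff)
    moreover have "- x / (lambda * - \<mu>) = x / (lambda * \<mu>)" by simp
    ultimately show ?thesis using \<open>\<mu> < 0\<close> by (simp add: I_MD_def power_rate_def)
  qed
  with False show ?thesis by (simp add: fun_eq_iff)
qed

section \<open>Moderate deviations\<close>

lemma power_div_fact_le_exp:
  fixes y :: real
  assumes "0 \<le> y"
  shows "y ^ n / fact n \<le> exp y"
proof -
  have "(\<Sum>k\<in>{n}. y ^ k /\<^sub>R fact k) \<le> (\<Sum>k. y ^ k /\<^sub>R fact k)"
    using assms by (intro sum_le_suminf summable_exp_generic) auto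
  then show ?thesis by (simp add: exp_def divide_inverse mult.commute)
qed

text \<open>The scaling \<open>m\<close> is chosen so that \<open>\<eta> ^ n * m\<close> stays constant; this form of the Taylor
  expansion also covers \<open>\<eta> = 0\<close>.\<close>

lemma (in prob_space) mgf_remainder_tendsto:
  fixes X :: "'a \<Rightarrow> real" and \<eta> m :: "real \<Rightarrow> real"
  assumes X [measurable]: "X \<in> borel_measurable M"
    and "0 < \<delta>" and mgf: "\<And>\<theta>. \<bar>\<theta>\<bar> < \<delta> \<Longrightarrow> integrable M (\<lambda>\<omega>. exp (\<theta> * X \<omega>))"
    and \<eta>: "(\<eta> \<longlongrightarrow> 0) at_top" and m: "\<forall>\<^sub>F t in at_top. \<eta> t ^ n * m t = w"
  shows "integrable M (\<lambda>\<omega>. X \<omega> ^ n)"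
    and "((\<lambda>t. expectation (\<lambda>\<omega>. (exp (\<eta> t * X \<omega>) - (\<Sum>k<n. (\<eta> t * X \<omega>) ^ k / fact k)) * m t))
      \<longlongrightarrow> w * expectation (\<lambda>\<omega>. X \<omega> ^ n) / fact n) at_top"
proof -
  \<comment> \<open>One multiple of \<open>c\<close> in the exponent absorbs
    \<open>\<bar>X \<omega>\<bar> ^ n\<close>, another dominates
    \<open>exp (\<eta> t * X \<omega>)\<close>, and \<open>2 * c\<close> still lies inside the
    interval of finite exponential moments.\<close>
  define c where "c = \<delta> / 3"
  have c: "0 < c" "2 * c < \<delta>" using \<open>0 < \<delta>\<close> by (auto simp: c_def)
  define W where "W \<omega> = exp (2 * c * X \<omega>) + exp (- 2 * c * X \<omega>)" for \<omega>
  have W: "integrable M W" unfolding W_def using c by (intro Bochner_Integration.integrable_add mgf) auto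
  have bound: "\<bar>X \<omega>\<bar> ^ n * exp (c * \<bar>X \<omega>\<bar>) \<le> fact n / c ^ n * W \<omega>" for \<omega>
  proof -
    have "\<bar>X \<omega>\<bar> ^ n = fact n / c ^ n * ((c * \<bar>X \<omega>\<bar>) ^ n / fact n)"
      using c by (simp add: power_mult_distrib)
    also have "\<dots> \<le> fact n / c ^ n * exp (c * \<bar>X \<omega>\<bar>)"
      using c by (intro mult_left_mono power_div_fact_le_exp) auto
    finally have "\<bar>X \<omega>\<bar> ^ n * exp (c * \<bar>X \<omega>\<bar>) \<le> fact n / c ^ n * exp (c * \<bar>X \<omega>\<bar>) * exp (c * \<bar>X \<omega>\<bar>)"
      by (rule mult_right_mono) simp
    also have "\<dots> = fact n / c ^ n * exp (2 * c * \<bar>X \<omega>\<bar>)"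
      by (simp add: exp_add[symmetric] mult.assoc)
    also have "\<dots> \<le> fact n / c ^ n * W \<omega>"
      using c by (intro mult_left_mono) (auto simp: W_def abs_if)
    finally show ?thesis .
  qed
  show "integrable M (\<lambda>\<omega>. X \<omega> ^ n)"
  proof (rule Bochner_Integration.integrable_bound)
    show "integrable M (\<lambda>\<omega>. fact n / c ^ n * W \<omega>)" using W by simp
    show "AE \<omega> in M. norm (X \<omega> ^ n) \<le> norm (fact n / c ^ n * W \<omega>)"
    proof (intro AE_I2)
      fix \<omega>
      have "\<bar>X \<omega>\<bar> ^ n * 1 \<le> \<bar>X \<omega>\<bar> ^ n * exp (c * \<bar>X \<omega>\<bar>)"
        using c by (intro mult_left_mono) auto
      also note bound[of \<omega>]
      also have "fact n / c ^ n * W \<omega> \<le> norm (fact n / c ^ n * W \<omega>)"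
        by (simp only: real_norm_def abs_ge_self)
      finally show "norm (X \<omega> ^ n) \<le> norm (fact n / c ^ n * W \<omega>)"
        by (simp only: real_norm_def power_abs mult_1_right)
    qed
  qed measurable
  let ?R = "\<lambda>t \<omega>. (exp (\<eta> t * X \<omega>) - (\<Sum>k<n. (\<eta> t * X \<omega>) ^ k / fact k)) * m t"
  \<comment> \<open>Lagrange's remainder: after scaling by \<open>m t\<close> it differs from the
    limit only by a factor \<open>exp z\<close> with
    \<open>\<bar>z\<bar> \<le> \<bar>\<eta> t * X \<omega>\<bar>\<close>. This yields both the
    pointwise limit and the dominating function.\<close>
  have R: "\<exists>z. \<bar>z\<bar> \<le> \<bar>\<eta> t * X \<omega>\<bar> \<and> ?R t \<omega> = exp z * (w * X \<omega> ^ n / fact n)" if "\<eta> t ^ n * m t = w" for t \<omega>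
  proof -
    obtain z where z: "\<bar>z\<bar> \<le> \<bar>\<eta> t * X \<omega>\<bar>"
      "exp (\<eta> t * X \<omega>) = (\<Sum>k<n. (\<eta> t * X \<omega>) ^ k / fact k) + exp z / fact n * (\<eta> t * X \<omega>) ^ n"
      using Maclaurin_exp_le by blast
    then have "?R t \<omega> = exp z / fact n * (\<eta> t * X \<omega>) ^ n * m t" by simp
    also have "\<dots> = exp z * ((\<eta> t ^ n * m t) * X \<omega> ^ n / fact n)" by (simp add: power_mult_distrib)
    finally show ?thesis using z(1) that by auto
  qed
  have "((\<lambda>t. expectation (?R t)) \<longlongrightarrow> expectation (\<lambda>\<omega>. w * X \<omega> ^ n / fact n)) at_top"
  proof (rule integral_dominated_convergence_at_top)
    show "integrable M (\<lambda>\<omega>. \<bar>w\<bar> / fact n * (fact n / c ^ n * W \<omega>))" using W by simp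
    show "AE \<omega> in M. ((\<lambda>t. ?R t \<omega>) \<longlongrightarrow> w * X \<omega> ^ n / fact n) at_top"
    proof (intro AE_I2)
      fix \<omega>
      let ?b = "w * X \<omega> ^ n / fact n"
      have lim: "((\<lambda>t. exp (s * \<bar>\<eta> t * X \<omega>\<bar>)) \<longlongrightarrow> 1) at_top" for s :: real
        by (rule tendsto_eq_intros \<eta> refl | simp)+
      have "((\<lambda>t. \<bar>?b\<bar> * (exp \<bar>\<eta> t * X \<omega>\<bar> - exp (- \<bar>\<eta> t * X \<omega>\<bar>))) \<longlongrightarrow> \<bar>?b\<bar> * (1 - 1)) at_top"
        using lim[of 1] lim[of "-1"] by (intro tendsto_intros) auto
      then have "((\<lambda>t. \<bar>?b\<bar> * (exp \<bar>\<eta> t * X \<omega>\<bar> - exp (- \<bar>\<eta> t * X \<omega>\<bar>))) \<longlongrightarrow> 0) at_top" by simp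
      moreover have "\<forall>\<^sub>F t in at_top. norm (?R t \<omega> - ?b) \<le> \<bar>?b\<bar> * (exp \<bar>\<eta> t * X \<omega>\<bar> - exp (- \<bar>\<eta> t * X \<omega>\<bar>))"
        using m
      proof eventually_elim
        case (elim t)
        from R[OF elim, of \<omega>] obtain z where z: "\<bar>z\<bar> \<le> \<bar>\<eta> t * X \<omega>\<bar>" "?R t \<omega> = exp z * ?b" by blast
        have "exp z \<le> exp \<bar>\<eta> t * X \<omega>\<bar>" "exp (- \<bar>\<eta> t * X \<omega>\<bar>) \<le> exp z" using z(1) by auto
        moreover have "1 \<le> exp \<bar>\<eta> t * X \<omega>\<bar>" "exp (- \<bar>\<eta> t * X \<omega>\<bar>) \<le> 1" by auto
        ultimately have "\<bar>exp z - 1\<bar> \<le> exp \<bar>\<eta> t * X \<omega>\<bar> - exp (- \<bar>\<eta> t * X \<omega>\<bar>)" by linarith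
        moreover have "?R t \<omega> - ?b = ?b * (exp z - 1)"
          unfolding z(2) by (simp only: right_diff_distrib mult_1_right mult.commute[of "exp z"])
        ultimately show ?case
          unfolding real_norm_def by (simp only: abs_mult) (intro mult_left_mono abs_ge_zero)
      qed
      ultimately show "((\<lambda>t. ?R t \<omega>) \<longlongrightarrow> ?b) at_top"
        by (rule Lim_null[THEN iffD2, OF Lim_null_comparison, rotated])
    qed
    have "\<forall>\<^sub>F t in at_top. \<bar>\<eta> t\<bar> < c"
      using \<eta> c(1) by (auto simp: tendsto_iff dist_real_def)
    with m show "\<forall>\<^sub>F t in at_top. AE \<omega> in M. norm (?R t \<omega>) \<le> \<bar>w\<bar> / fact n * (fact n / c ^ n * W \<omega>)"
    proof eventually_elim
      case (elim t)
      show ?case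
      proof (intro AE_I2)
        fix \<omega>
        from R[OF elim(1), of \<omega>] obtain z where z: "\<bar>z\<bar> \<le> \<bar>\<eta> t * X \<omega>\<bar>" "?R t \<omega> = exp z * (w * X \<omega> ^ n / fact n)" by blast
        have "\<bar>\<eta> t * X \<omega>\<bar> \<le> c * \<bar>X \<omega>\<bar>"
          unfolding abs_mult using elim(2) by (intro mult_right_mono) auto
        then have "exp z \<le> exp (c * \<bar>X \<omega>\<bar>)" using z(1) by auto
        have "norm (?R t \<omega>) = \<bar>w\<bar> / fact n * (\<bar>X \<omega>\<bar> ^ n * exp z)"
          unfolding z(2) by (simp add: abs_mult power_abs)
        also have "\<dots> \<le> \<bar>w\<bar> / fact n * (\<bar>X \<omega>\<bar> ^ n * exp (c * \<bar>X \<omega>\<bar>))"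
          using \<open>exp z \<le> _\<close> by (intro mult_left_mono) auto
        also have "\<dots> \<le> \<bar>w\<bar> / fact n * (fact n / c ^ n * W \<omega>)"
          by (intro mult_left_mono bound) auto
        finally show "norm (?R t \<omega>) \<le> \<bar>w\<bar> / fact n * (fact n / c ^ n * W \<omega>)" .
      qed
    qed
  qed measurable
  then show "((\<lambda>t. expectation (?R t)) \<longlongrightarrow> w * expectation (\<lambda>\<omega>. X \<omega> ^ n) / fact n) at_top" by simp
qed

theorem proposition3p3:
  fixes M :: "'a measure"
    and X :: "nat \<Rightarrow> 'a \<Rightarrow> real"
    and N :: "real \<Rightarrow> 'a \<Rightarrow> nat"
    and a :: "real \<Rightarrow> real"
    and \<nu> lambda \<mu> \<sigma>2 :: real
  assumes prob: "prob_space M"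
    and nu: "0 < \<nu>" "\<nu> < 1"
    and lambda_pos: "0 < lambda"
    and X_indep: "prob_space.indep_vars M (\<lambda>_. borel) X {1..}"
    and X_ident: "\<And>n. n \<ge> 1 \<Longrightarrow> distr M borel (X n) = distr M borel (X 1)"
    and X_mgf: "\<exists>\<delta>>0. \<forall>\<theta>. \<bar>\<theta>\<bar> < \<delta> \<longrightarrow> integrable M (\<lambda>\<omega>. exp (\<theta> * X 1 \<omega>))"
    and mu: "\<mu> = prob_space.expectation M (X 1)"
    and sigma2: "\<sigma>2 = prob_space.variance M (X 1)"
    and sigma2_pos: "\<mu> = 0 \<Longrightarrow> \<sigma>2 > 0"
    and N_tfpp: "prob_space.time_fractional_poisson_process M \<nu> lambda N"
    and N_X_indep: "prob_space.indep_families M borel {1..} X (count_space UNIV) {0..} N"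
    and a_pos: "\<And>t. t > 0 \<Longrightarrow> a t > 0"
    and a_lim: "(a \<longlongrightarrow> 0) at_top"
    and ta_lim: "filterlim (\<lambda>t. t * a t) at_top at_top"
  shows "prob_space.satisfies_LDP M
           (\<lambda>t \<omega>. (a t * t) powr scaling_exponent \<nu> \<mu> * random_sum X N t \<omega> / t)
           (\<lambda>t. 1 / a t)
           (I_MD \<nu> lambda \<mu> \<sigma>2)
         \<and> good_rate_function (I_MD \<nu> lambda \<mu> \<sigma>2)"
proof -
  interpret prob_space M by fact
  define \<alpha> where "\<alpha> = scaling_exponent \<nu> \<mu>"
  define Z where "Z t \<omega> = (a t * t) powr \<alpha> * random_sum X N t \<omega> / t" for t \<omega>
  obtain N1 L where N1: "poisson_process lambda N1" and L: "inverse_stable_subordinator \<nu> L"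
    and indep_L: "indep_families (count_space UNIV) {0..} N1 borel {0..} L"
    and N: "AE \<omega> in M. \<forall>t\<ge>0. N t \<omega> = N1 (L t \<omega>) \<omega>"
    using N_tfpp by (auto simp: time_fractional_poisson_process_def)
  have N_meas: "N t \<in> measurable M (count_space UNIV)" if "0 \<le> t" for t
    using N_tfpp that by (auto simp: time_fractional_poisson_process_def)
  have X_meas: "X k \<in> borel_measurable M" if "1 \<le> k" for k
    using X_indep that by (auto simp: indep_vars_def)
  have Z_meas: "Z t \<in> borel_measurable M" if "0 < t" for t
    using random_sum_measurable[of X N t, OF X_meas N_meas] that unfolding Z_def by auto
  obtain \<delta> where "0 < \<delta>" and mgf: "\<And>\<theta>. \<bar>\<theta>\<bar> < \<delta> \<Longrightarrow> integrable M (\<lambda>\<omega>. exp (\<theta> * X 1 \<omega>))"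
    using X_mgf by blast
  have "X 1 \<in> borel_measurable M" by (rule X_meas) simp

  \<comment> \<open>Rescaled cumulants and their limits\<close>
  define \<phi> where "\<phi> \<eta> = expectation (\<lambda>\<omega>. exp (\<eta> * X 1 \<omega>))" for \<eta>
  \<comment> \<open>\<open>\<theta> * Z t \<omega> / a t\<close> equals
    \<open>\<eta> \<theta> t\<close> times the random sum. Since \<open>\<alpha> < 1\<close> and
    \<open>a t * t\<close> tends to infinity, \<open>\<eta> \<theta> t\<close> enters the interval
    where the moment generating function is finite, whatever \<open>\<theta>\<close> is.\<close>
  define \<eta> where "\<eta> \<theta> t = \<theta> * (a t * t) powr (\<alpha> - 1)" for \<theta> t
  define m where "m t = (a t * t) powr \<nu>" for t
  define r where "r \<theta> t = lambda * (\<phi> (\<eta> \<theta> t) - 1) * m t" for \<theta> t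
  define r0 where "r0 \<theta> = (if \<mu> = 0 then lambda * \<sigma>2 / 2 * \<theta>\<^sup>2 else lambda * \<mu> * \<theta>)" for \<theta>
  define \<Lambda> where "\<Lambda> \<theta> = max (r0 \<theta>) 0 powr (1 / \<nu>)" for \<theta>
  have \<alpha>: "\<alpha> < 1" using nu by (simp add: \<alpha>_def scaling_exponent_def)
  have at: "filterlim (\<lambda>t. a t * t) at_top at_top" using ta_lim by (simp add: mult.commute)
  have \<eta>_lim: "(\<eta> \<theta> \<longlongrightarrow> 0) at_top" for \<theta>
  proof -
    have "((\<lambda>t. (a t * t) powr (\<alpha> - 1)) \<longlongrightarrow> 0) at_top"
      using \<alpha> by (intro tendsto_neg_powr at) simp
    from tendsto_mult_left[OF this, of \<theta>] show ?thesis by (simp add: \<eta>_def[abs_def])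
  qed
  \<comment> \<open>Taking \<open>m\<close> to be 0 satisfies the scaling hypothesis trivially and
    leaves the integrability conclusion.\<close>
  have integrable_X: "integrable M (X 1)"
    using mgf_remainder_tendsto(1)[OF \<open>X 1 \<in> _\<close> \<open>0 < \<delta>\<close> mgf tendsto_const, where n = 1 and m = "\<lambda>_. 0"] by simp
  have r_lim: "(r \<theta> \<longlongrightarrow> r0 \<theta>) at_top" for \<theta>
  proof -
    have pos: "\<forall>\<^sub>F t in at_top. 0 < a t * t"
      using eventually_gt_at_top[of 0] by eventually_elim (use a_pos in simp)
    have small: "\<forall>\<^sub>F t in at_top. \<bar>\<eta> \<theta> t\<bar> < \<delta>"
      using \<eta>_lim[of \<theta>] \<open>0 < \<delta>\<close> by (auto simp: tendsto_iff dist_real_def)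
    \<comment> \<open>\<open>n\<close> is the order of the first Taylor term whose moment does not
      vanish. The scaling exponent is determined by \<open>n * (\<alpha> - 1) + \<nu> = 0\<close>,
      which balances this term against \<open>m t\<close>.\<close>
    define n :: nat where "n = (if \<mu> = 0 then 2 else 1)"
    have n\<alpha>: "real n * (\<alpha> - 1) + \<nu> = 0"
      by (simp add: n_def \<alpha>_def scaling_exponent_def)
    have "\<forall>\<^sub>F t in at_top. \<eta> \<theta> t ^ n * m t = \<theta> ^ n"
      using pos
    proof eventually_elim
      case (elim t)
      have "((a t * t) powr (\<alpha> - 1)) ^ n = ((a t * t) powr (\<alpha> - 1)) powr real n"
        using elim by (intro powr_realpow[symmetric]) auto
      then have "((a t * t) powr (\<alpha> - 1)) ^ n * (a t * t) powr \<nu> = (a t * t) powr (real n * (\<alpha> - 1) + \<nu>)"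
        by (simp only: powr_add powr_powr mult.commute[of "real n"])
      also have "\<dots> = 1" unfolding n\<alpha> using elim by auto
      finally show ?case by (simp add: \<eta>_def m_def power_mult_distrib mult.assoc)
    qed
    from mgf_remainder_tendsto(2)[OF \<open>X 1 \<in> _\<close> \<open>0 < \<delta>\<close> mgf \<eta>_lim this]
    have "((\<lambda>t. expectation (\<lambda>\<omega>. (exp (\<eta> \<theta> t * X 1 \<omega>) - (\<Sum>k<n. (\<eta> \<theta> t * X 1 \<omega>) ^ k / fact k)) * m t))
      \<longlongrightarrow> \<theta> ^ n * expectation (\<lambda>\<omega>. X 1 \<omega> ^ n) / fact n) at_top" by simp
    moreover have "\<forall>\<^sub>F t in at_top. expectation (\<lambda>\<omega>. (exp (\<eta> \<theta> t * X 1 \<omega>) - (\<Sum>k<n. (\<eta> \<theta> t * X 1 \<omega>) ^ k / fact k)) * m t)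
        = (\<phi> (\<eta> \<theta> t) - 1) * m t"
      using small
    proof eventually_elim
      case (elim t)
      note int = mgf[OF elim]
      have "(\<Sum>k<n. (\<eta> \<theta> t * X 1 \<omega>) ^ k / fact k) = 1 + (if \<mu> = 0 then \<eta> \<theta> t * X 1 \<omega> else 0)" for \<omega>
        by (simp add: n_def numeral_2_eq_2)
      then have "expectation (\<lambda>\<omega>. (exp (\<eta> \<theta> t * X 1 \<omega>) - (\<Sum>k<n. (\<eta> \<theta> t * X 1 \<omega>) ^ k / fact k)) * m t)
        = expectation (\<lambda>\<omega>. exp (\<eta> \<theta> t * X 1 \<omega>) - (1 + (if \<mu> = 0 then \<eta> \<theta> t else 0) * X 1 \<omega>)) * m t"
        by (simp cong: if_cong)
      also have "expectation (\<lambda>\<omega>. exp (\<eta> \<theta> t * X 1 \<omega>) - (1 + (if \<mu> = 0 then \<eta> \<theta> t else 0) * X 1 \<omega>))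
        = \<phi> (\<eta> \<theta> t) - (1 + (if \<mu> = 0 then \<eta> \<theta> t else 0) * \<mu>)"
        using int integrable_X by (simp add: \<phi>_def mu prob_space)
      also have "(if \<mu> = 0 then \<eta> \<theta> t else 0) * \<mu> = 0" by simp
      finally show ?case by simp
    qed
    ultimately have "((\<lambda>t. (\<phi> (\<eta> \<theta> t) - 1) * m t) \<longlongrightarrow> \<theta> ^ n * expectation (\<lambda>\<omega>. X 1 \<omega> ^ n) / fact n) at_top"
      by (rule Lim_transform_eventually)
    from tendsto_mult_left[OF this, of lambda]
    have "(r \<theta> \<longlongrightarrow> lambda * (\<theta> ^ n * expectation (\<lambda>\<omega>. X 1 \<omega> ^ n) / fact n)) at_top"
      by (simp add: r_def[abs_def] mult.assoc)
    moreover have "lambda * (\<theta> ^ n * expectation (\<lambda>\<omega>. X 1 \<omega> ^ n) / fact n) = r0 \<theta>"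
      using sigma2 mu by (auto simp: n_def r0_def)
    ultimately show ?thesis by simp
  qed
  have mgf_Z: "\<forall>\<^sub>F t in at_top. (\<integral>\<^sup>+\<omega>. ennreal (exp (\<theta> * Z t \<omega> / a t)) \<partial>M)
      = (\<integral>\<^sup>+\<omega>. ennreal (exp (r \<theta> t * (a t * t) powr - \<nu> * L t \<omega>)) \<partial>M)" for \<theta>
  proof -
    have small: "\<forall>\<^sub>F t in at_top. \<bar>\<eta> \<theta> t\<bar> < \<delta>"
      using \<eta>_lim[of \<theta>] \<open>0 < \<delta>\<close> by (auto simp: tendsto_iff dist_real_def)
    with eventually_gt_at_top[of 0] show ?thesis
    proof eventually_elim
      case (elim t)
      have "0 < a t" using elim(1) by (rule a_pos)
      have "(a t * t) powr \<alpha> / (a t * t) = (a t * t) powr (\<alpha> - 1)"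
        using \<open>0 < a t\<close> elim(1) by (simp add: powr_diff)
      then have scale: "\<eta> \<theta> t = \<theta> * ((a t * t) powr \<alpha> / (a t * t))" by (simp only: \<eta>_def)
      have Z_eq: "\<theta> * Z t \<omega> / a t = \<eta> \<theta> t * random_sum X N t \<omega>" for \<omega>
        unfolding scale Z_def by (simp add: mult_ac)
      have "(a t * t) powr \<nu> * (a t * t) powr - \<nu> = 1"
        using \<open>0 < a t\<close> elim(1) by (simp add: powr_minus)
      then have r_eq: "r \<theta> t * (a t * t) powr - \<nu> = lambda * (\<phi> (\<eta> \<theta> t) - 1)"
        by (simp add: r_def m_def mult.assoc)
      show ?case
        unfolding Z_eq r_eq \<phi>_def
        by (rule nn_integral_exp_random_sum_fractional[OF X_indep X_ident N_X_indep less_imp_le[OF elim(1)]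
              N1 lambda_pos L indep_L N mgf[OF elim(2)]])
    qed
  qed
  have upper: "log_limsup_le a at_top (\<lambda>t. \<integral>\<^sup>+\<omega>. ennreal (exp (\<theta> * Z t \<omega> / a t)) \<partial>M) (\<Lambda> \<theta>)" for \<theta>
    unfolding \<Lambda>_def
    by (rule log_limsup_le_mono[OF log_limsup_le_exp_inverse_stable_subordinator[OF L nu(1) a_pos a_lim r_lim]])
       (assumption, rule eventually_mono[OF mgf_Z[of \<theta>]], simp)
  have lower: "log_liminf_ge a at_top (\<lambda>t. \<integral>\<^sup>+\<omega>. ennreal (exp (\<theta> * Z t \<omega> / a t)) \<partial>M) (\<Lambda> \<theta>)" for \<theta>
    unfolding \<Lambda>_def
    by (rule log_liminf_ge_mono[OF log_liminf_ge_exp_inverse_stable_subordinator[OF L nu a_pos a_lim r_lim]])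
       (assumption, rule eventually_mono[OF mgf_Z[of \<theta>]], simp)

  \<comment> \<open>Duality between the limit cumulant and the rate function\<close>
  define q where "q = (if \<mu> = 0 then \<nu> / 2 else \<nu>)"
  define k where "k = (if \<mu> = 0 then sqrt (lambda * \<sigma>2 / 2) else lambda * \<bar>\<mu>\<bar>)"
  define S where "S = (if \<mu> = 0 then UNIV else {x. 0 \<le> \<mu> * x})"
  have q: "0 < q" "q < 1" using nu by (auto simp: q_def)
  have k: "0 < k" using lambda_pos sigma2_pos by (auto simp: k_def)
  have I: "I_MD \<nu> lambda \<mu> \<sigma>2 = power_rate q k S"
    using I_MD_eq_power_rate[OF nu lambda_pos sigma2_pos] by (simp add: q_def k_def S_def)
  have "closed S" by (auto simp: S_def intro!: closed_Collect_le continuous_intros)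
  have cone: "x \<in> S \<longleftrightarrow> x = 0 \<or> sgn x \<in> S" for x
    by (auto simp: S_def zero_le_mult_iff sgn_if split: if_splits)
  have \<Lambda>_in: "\<Lambda> (s * \<zeta>) = (k * \<zeta>) powr (1 / q)" if s: "s = 1 \<or> s = - 1" "s \<in> S" and "0 < \<zeta>" for s \<zeta>
  proof (cases "\<mu> = 0")
    case True
    let ?K = "lambda * \<sigma>2 / 2"
    have "0 < ?K" using lambda_pos sigma2_pos True by simp
    have "r0 (s * \<zeta>) = (k * \<zeta>)\<^sup>2" using True s(1) \<open>0 < ?K\<close> by (auto simp: r0_def k_def power_mult_distrib)
    then have "\<Lambda> (s * \<zeta>) = ((k * \<zeta>) powr 2) powr (1 / \<nu>)"
      using k \<open>0 < \<zeta>\<close> by (simp add: \<Lambda>_def max_absorb1)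
    also have "\<dots> = (k * \<zeta>) powr (1 / q)" unfolding powr_powr using True by (simp add: q_def)
    finally show ?thesis .
  next
    case False
    then have "0 \<le> \<mu> * s" using s(2) by (simp add: S_def)
    then have "\<mu> * s = \<bar>\<mu>\<bar>" using s(1) by auto
    have "r0 (s * \<zeta>) = lambda * (\<mu> * s) * \<zeta>" using False by (simp add: r0_def)
    also have "\<dots> = k * \<zeta>" unfolding \<open>\<mu> * s = \<bar>\<mu>\<bar>\<close> using False by (simp add: k_def)
    finally show ?thesis using False k \<open>0 < \<zeta>\<close> by (simp add: \<Lambda>_def q_def max_absorb1)
  qed
  have \<Lambda>_out: "\<Lambda> (s * \<zeta>) = 0" if s: "s = 1 \<or> s = - 1" "s \<notin> S" and "0 < \<zeta>" for s \<zeta>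
  proof -
    have "\<mu> \<noteq> 0" "\<mu> * s < 0" using s(2) by (auto simp: S_def split: if_splits)
    then have "r0 (s * \<zeta>) = (lambda * \<zeta>) * (\<mu> * s)" by (simp add: r0_def)
    also have "\<dots> \<le> 0" 
      by (rule mult_nonneg_nonpos) (use \<open>\<mu> * s < 0\<close> \<open>0 < \<zeta>\<close> lambda_pos in auto)
    finally show ?thesis by (simp add: \<Lambda>_def max_absorb2)
  qed
  have "\<Lambda> 0 = 0" by (simp add: \<Lambda>_def r0_def)
  have good: "good_rate_function (power_rate q k S)"
    by (rule good_rate_function_power_rate[OF q k \<open>closed S\<close>])
  have "power_rate q k S 0 = 0"
    using cone[of 0] by (simp add: power_rate_def)
  then have "satisfies_LDP Z (\<lambda>t. 1 / a t) (power_rate q k S)"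
  proof (rule gartner_ellis[OF Z_meas a_pos a_lim lower upper, rotated 3])
    show "rate_function (power_rate q k S)" using good by (simp add: good_rate_function_def)
  next
    fix x assume finite: "power_rate q k S x \<noteq> \<infinity>"
    show "\<exists>\<theta>. (\<Lambda> has_real_derivative x) (at \<theta>) \<and> power_rate q k S x = ereal (\<theta> * x - \<Lambda> \<theta>) \<and> 0 \<le> \<theta> * x"
      by (rule power_rate_legendre(1)[OF q k cone \<open>\<Lambda> 0 = 0\<close> \<Lambda>_in \<Lambda>_out finite])
  next
    fix x c assume infinite: "power_rate q k S x = \<infinity>"
    show "\<exists>\<theta>. 0 \<le> \<theta> * x \<and> c \<le> \<theta> * x - \<Lambda> \<theta>"
      by (rule power_rate_legendre(2)[OF q k cone \<open>\<Lambda> 0 = 0\<close> \<Lambda>_in \<Lambda>_out infinite])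
  qed
  with good show ?thesis unfolding I Z_def \<alpha>_def by simp
qed

end
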